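(* Let $G$ be a nontrivial finite solvable group. Then the prime graph $\Gamma_G$ has girth $3$, aside from the following exceptions (up to isomorphism), each of which does occur as the prime graph of a finite solvable group: the $4$-cycle, the $5$-cycle, and the nonempty forests that do not contain an independent set of size $3$, of which there are exactly $7$ up to isomorphism.
   Context: For a finite group $G$, let $\pi(G)$ be the set of prime divisors of $|G|$. The prime graph $\Gamma_G$ is the simple undirected graph with vertex set $\pi(G)$ in which two distinct primes $p,q$ are joined by an edge if and only if $G$ contains an element of order $pq$. The girth of a graph is the length of a shortest cycle in it (infinite if the graph is a forest). "Nonempty" means having at least one vertex. *)

theory Defs
  imports
    "HOL-Algebra.Solvable_Groups"
    "HOL-Algebra.Multiplicative_Group"
    "HOL-Computational_Algebra.Primes"
    "HOL-Library.Extended_Nat"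
    "Graph_Theory.Graph_Theory"
begin

text \<open>
  Finite simple undirected graphs are the symmetric loop-free finite digraphs of the
  library (locale \<^locale>\<open>pair_graph\<close>): an undirected edge joining u and v is the
  pair of arcs (u, v), (v, u).
\<close>

definition prime_graph :: "('a, 'b) monoid_scheme \<Rightarrow> nat pair_pre_digraph" where
  "prime_graph G =
     \<lparr> pverts = prime_factors (order G),
       parcs = {(p, q). p \<in> prime_factors (order G) \<and> q \<in> prime_factors (order G) \<and> p \<noteq> q \<and>
                        (\<exists>x \<in> carrier G. group.ord G x = p * q)} \<rparr>"

lemma pair_graph_prime_graph: "pair_graph (prime_graph G)"
proof -
  have "parcs (prime_graph G) \<subseteq> prime_factors (order G) \<times> prime_factors (order G)"
    by (auto simp: prime_graph_def)
  then have "finite (parcs (prime_graph G))"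
    by (rule finite_subset) simp
  then show ?thesis
    by unfold_locales (auto simp: prime_graph_def symmetric_def sym_def mult.commute)
qed

text \<open>
  In a symmetric digraph the closed walk u, v, u counts as a cycle of length 2; the cycles
  of the underlying undirected simple graph are those of length at least 3.
\<close>

definition ucycle :: "('a, 'b) pre_digraph \<Rightarrow> 'b awalk \<Rightarrow> bool" where
  "ucycle G p \<longleftrightarrow> pre_digraph.cycle G p \<and> 3 \<le> length p"

definition girth :: "('a, 'b) pre_digraph \<Rightarrow> enat" where
  "girth G = (INF p \<in> {p. ucycle G p}. enat (length p))"

text \<open>
  The library's \<^const>\<open>forest\<close> forbids 2-cycles as well, so it does not describe
  undirected forests.
\<close>

definition uforest :: "('a, 'b) pre_digraph \<Rightarrow> bool" where
  "uforest G \<longleftrightarrow> (\<nexists>p. ucycle G p)"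

lemma girth_eq_infinity_iff: "girth G = \<infinity> \<longleftrightarrow> uforest G"
  by (auto simp: girth_def uforest_def INF_top_conv simp flip: top_enat_def)
    (auto simp: top_enat_def)

definition independent_set :: "('a, 'b) pre_digraph \<Rightarrow> 'a set \<Rightarrow> bool" where
  "independent_set G S \<longleftrightarrow> S \<subseteq> verts G \<and> (\<forall>u \<in> S. \<forall>v \<in> S. (u, v) \<notin> arcs_ends G)"

definition cycle_graph :: "nat \<Rightarrow> nat pair_pre_digraph" where
  "cycle_graph n =
     \<lparr> pverts = {..<n},
       parcs = {(i, j). i < n \<and> j < n \<and> (j = Suc i mod n \<or> i = Suc j mod n)} \<rparr>"

lemma pair_graph_cycle_graph:
  assumes "3 \<le> n"
  shows "pair_graph (cycle_graph n)"
proof -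
  have "parcs (cycle_graph n) \<subseteq> {..<n} \<times> {..<n}"
    by (auto simp: cycle_graph_def)
  then have "finite (parcs (cycle_graph n))"
    by (rule finite_subset) simp
  moreover have "Suc i mod n \<noteq> i" if "i < n" for i
    using that assms by (cases "Suc i = n") auto
  ultimately show ?thesis
    by unfold_locales (auto simp: cycle_graph_def symmetric_def sym_def, metis+)
qed

definition exceptional_forest :: "'a pair_pre_digraph \<Rightarrow> bool" where
  "exceptional_forest F \<longleftrightarrow>
     pair_graph F \<and> uforest F \<and> pverts F \<noteq> {} \<and> \<not> (\<exists>S. independent_set F S \<and> card S = 3)"

definition occurs_as_solvable_prime_graph :: "'a pair_pre_digraph \<Rightarrow> bool" where
  \<comment> \<open>Every finite group is isomorphic to one whose carrier is a set of natural numbers.\<close>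
  "occurs_as_solvable_prime_graph F \<longleftrightarrow>
     (\<exists>H :: nat monoid. group H \<and> finite (carrier H) \<and> solvable H \<and> digraph_iso (prime_graph H) F)"

end

theory Submission
  imports Defs "HOL-Algebra.Sylow" "HOL-Algebra.Group_Action" "HOL-Algebra.Elementary_Groups"
    "HOL-Number_Theory.Cong"
begin

text \<open>
  A triangle-free graph with at most two pairwise non-adjacent vertices has at most five vertices:
  both the neighbours and the non-neighbours of a vertex number at most two. Going through the cases
  leaves the 4-cycle, the 5-cycle and seven forests, told apart by their numbers of vertices and arcs.

  A prime graph of a solvable group has no three pairwise non-adjacent vertices. Each of three such
  primes would first leave the order along the derived series at a different step, since an abelian
  factor whose order is divisible by two of them contains an element of the product order. Let \<open>q\<close>,
  \<open>r\<close>, \<open>p\<close> be the order of departure, and divide out the term following the departure of \<open>p\<close>. By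
  Frattini's argument some element \<open>h\<close> of order \<open>q\<close> normalizes a nontrivial \<open>r\<close>-group \<open>R\<close>, and
  \<open>R\<close> and \<open>h\<close> act on an abelian normal subgroup with \<open>p\<close>-torsion, all of these actions being free of
  fixed points. A count over the group generated by \<open>R\<close> and \<open>h\<close> rules this out.

  For the converse, let a group \<open>H\<close> act on an abelian group \<open>V\<close> of coprime order. In the semidirect
  product the primes dividing the order of \<open>V\<close> are pairwise adjacent, those of \<open>H\<close> are adjacent as
  they are in \<open>H\<close>, and a prime of \<open>V\<close> is adjacent to a prime \<open>q\<close> of \<open>H\<close> iff an element of order \<open>q\<close>
  fixes an element of the former order. Cyclic \<open>V\<close> and \<open>H\<close> suffice for everything but the 5-cycle,
  which needs a nonabelian \<open>H\<close>.
\<close>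

section \<open>Elements of prime order and Sylow subgroups\<close>

context group
begin

lemma ord_eqI_prime:
  assumes "x \<in> carrier G" "prime p" "x [^] p = \<one>" "x \<noteq> \<one>"
  shows "ord x = p"
  using assms pow_eq_id[of x p] ord_eq_1[of x] by (auto simp: prime_nat_iff)

lemma ord_dvd_card_subgroup:
  assumes "subgroup H G" "finite H" "x \<in> H"
  shows "ord x dvd card H"
proof -
  interpret H: group "G\<lparr>carrier := H\<rparr>" using assms(1) by (rule subgroup_imp_group)
  have "x [^]\<^bsub>G\<lparr>carrier := H\<rparr>\<^esub> order (G\<lparr>carrier := H\<rparr>) = \<one>"
    using assms H.pow_order_eq_1[of x] by simp
  then have "x [^] card H = \<one>"
    by (simp add: order_def nat_pow_consistent[symmetric])
  then show ?thesis
    using assms subgroup.mem_carrier pow_eq_id by metis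
qed

lemma exists_pow_ord_eq:
  assumes "finite (carrier G)" "x \<in> carrier G" "n dvd ord x"
  shows "\<exists>k. ord (x [^] (k::nat)) = n"
proof -
  have "ord x \<noteq> 0" using ord_ge_1[OF assms(1,2)] by simp
  moreover obtain k where "ord x = n * k" using assms(3) by blast
  ultimately have "ord (x [^] k) = n" using ord_pow[OF assms(2), of k] by auto
  then show ?thesis ..
qed

text \<open>\<open>sylow_thm\<close> allows the cofactor to be divisible by the prime, so with
  exponent 1 it yields a subgroup of order \<open>p\<close>, all of whose nontrivial elements have
  order \<open>p\<close>.\<close>

theorem cauchy:
  assumes "finite (carrier G)" "subgroup H G" "prime p" "p dvd card H"
  shows "\<exists>x \<in> H. ord x = p"
proof -
  interpret H: group "G\<lparr>carrier := H\<rparr>" using assms(2) by (rule subgroup_imp_group)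
  have finH: "finite H" using assms(1,2) subgroup.subset finite_subset by metis
  obtain m where "order (G\<lparr>carrier := H\<rparr>) = p ^ 1 * m"
    using assms(4) by (auto simp: order_def)
  then obtain K where K: "subgroup K (G\<lparr>carrier := H\<rparr>)" "card K = p"
    using sylow_thm[OF assms(3) H.is_group, of 1 m] finH by auto
  then have KG: "subgroup K G" "K \<subseteq> H"
    using assms(2) incl_subgroup subgroup.subset by fastforce+
  have "finite K" using KG finH finite_subset by blast
  have "K \<noteq> {\<one>}" using K assms(3) by auto
  then obtain x where x: "x \<in> K" "x \<noteq> \<one>"
    using subgroup.one_closed[OF KG(1)] by blast
  then have xG: "x \<in> carrier G" using KG subgroup.subset by blast
  have "ord x dvd p" using ord_dvd_card_subgroup[OF KG(1) \<open>finite K\<close> x(1)] K by simp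
  then have "ord x = p" using x xG assms(3) ord_eq_1 by (auto simp: prime_nat_iff)
  then show ?thesis using x KG by blast
qed

text \<open>If \<open>n\<close> is the order of the product, raising
  \<open>x [^] n \<otimes> y [^] n = \<one>\<close> to the power \<open>q\<close> removes
  \<open>y\<close> and forces \<open>p\<close> to divide \<open>n\<close>; the power
  \<open>p\<close> does the same for \<open>q\<close>.\<close>

lemma ord_mult_commuting_primes:
  assumes "x \<in> carrier G" "y \<in> carrier G" "x \<otimes> y = y \<otimes> x"
    and "ord x = p" "ord y = q" "prime p" "prime q" "p \<noteq> q"
  shows "ord (x \<otimes> y) = p * q"
proof -
  have pw: "(x \<otimes> y) [^] n = x [^] n \<otimes> y [^] n" for n :: nat
    using assms(1-3) by (rule pow_mult_distrib[rotated])
  have cop: "coprime p q" using assms by (simp add: primes_coprime)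
  let ?n = "ord (x \<otimes> y)"
  have xy: "x [^] ?n \<otimes> y [^] ?n = \<one>" using pw[of ?n] assms by simp
  have "x [^] (?n * q) \<otimes> y [^] (?n * q) = (x [^] ?n \<otimes> y [^] ?n) [^] q"
    using assms pw by (metis m_closed nat_pow_pow)
  also have "\<dots> = \<one>" using xy by simp
  finally have "x [^] (?n * q) = \<one>" using assms pow_eq_id[of y "?n * q"] by simp
  then have "p dvd ?n * q" using assms pow_eq_id by blast
  then have p: "p dvd ?n" using cop by (simp add: coprime_dvd_mult_left_iff)
  have "x [^] (?n * p) \<otimes> y [^] (?n * p) = (x [^] ?n \<otimes> y [^] ?n) [^] p"
    using assms pw by (metis m_closed nat_pow_pow)
  also have "\<dots> = \<one>" using xy by simp
  finally have "y [^] (?n * p) = \<one>" using assms pow_eq_id[of x "?n * p"] by simp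
  then have "q dvd ?n * p" using assms pow_eq_id by blast
  then have "q dvd ?n" using cop by (simp add: coprime_dvd_mult_left_iff coprime_commute)
  then have "p * q dvd ?n" using p cop by (simp add: divides_mult)
  moreover have "?n dvd p * q" using ord_mul_divides assms by metis
  ultimately show ?thesis by (rule dvd_antisym[symmetric])
qed

end

lemma (in group_hom) ord_hom_dvd:
  assumes "x \<in> carrier G"
  shows "H.ord (h x) dvd G.ord x"
proof -
  have "h x [^]\<^bsub>H\<^esub> G.ord x = \<one>\<^bsub>H\<^esub>"
    using assms by (simp flip: hom_nat_pow)
  then show ?thesis using assms H.pow_eq_id by simp
qed

text \<open>A suitable power of \<open>x\<close> has the order of its image. This carries elements
  of order \<open>p * q\<close> from a quotient back to the group, so missing edges stay missing in
  quotients.\<close>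

lemma (in group_hom) exists_ord_lift:
  assumes "finite (carrier G)" "x \<in> carrier G"
  shows "\<exists>y \<in> carrier G. G.ord y = H.ord (h x)"
  using G.exists_pow_ord_eq[OF assms ord_hom_dvd[OF assms(2)]] assms by blast

text \<open>Orbit sizes divide \<open>p ^ a\<close>; if each exceeded 1, \<open>p\<close> would
  divide all of them and hence \<open>card E\<close>.\<close>

lemma (in group_action) exists_fixed_point:
  assumes "prime p" "order G = p ^ a" "finite E" "\<not> p dvd card E"
  shows "\<exists>e \<in> E. \<forall>g \<in> carrier G. \<phi> g e = e"
proof -
  interpret G: group G using group_hom by (simp add: group_hom_def)
  have "(\<Sum>R \<in> orbits G E \<phi>. card R) = card E"
    using disjoint_sum[OF assms(3), of "\<lambda>_. 1 :: nat"] by simp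
  then obtain R where R: "R \<in> orbits G E \<phi>" "\<not> p dvd card R"
    using assms(4) by (metis dvd_sum)
  then obtain e where e: "e \<in> E" "R = orbit G \<phi> e" by (auto simp: orbits_def)
  have "card R dvd p ^ a"
    using orbit_stabilizer_theorem[OF e(1)] assms(2) e(2) by (metis dvd_triv_left)
  then have "card R = 1"
    using R(2) assms(1) divides_primepow_nat[of p "card R" a] by (metis dvd_power gr0I power_0)
  then have "R = {e}"
    using orbit_refl[OF e(1)] e(2) by (metis card_1_singletonE singletonD)
  then have "\<phi> g e = e" if "g \<in> carrier G" for g
    using that e(2) by (auto simp: orbit_def)
  then show ?thesis using e(1) by blast
qed

section \<open>Conjugation into Sylow subgroups and Frattini's argument\<close>

context group
begin

text \<open>The inverse turns right multiplication into a left action, that is, a homomorphism into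
  the permutations of the cosets.\<close>

lemma right_mult_action_on_cosets:
  assumes H: "subgroup H G" and P: "subgroup P G"
  shows "group_action (G\<lparr>carrier := P\<rparr>) (rcosets H) (\<lambda>g. \<lambda>C \<in> rcosets H. C #> inv g)"
proof -
  interpret P: group "G\<lparr>carrier := P\<rparr>" using P by (rule subgroup_imp_group)
  have PG: "g \<in> carrier G" if "g \<in> P" for g using that P subgroup.subset by blast
  have HG: "H \<subseteq> carrier G" using H subgroup.subset by blast
  have cl: "C #> g \<in> rcosets H" if "C \<in> rcosets H" "g \<in> carrier G" for C g
    using that HG by (auto simp: RCOSETS_def coset_mult_assoc)
  have sub: "C \<subseteq> carrier G" if "C \<in> rcosets H" for C
    using that r_coset_subset_G[OF HG] by (auto simp: RCOSETS_def)
  let ?f = "\<lambda>g. \<lambda>C \<in> rcosets H. C #> inv g"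
  have bij: "?f g \<in> Bij (rcosets H)" if "g \<in> P" for g
  proof -
    have "bij_betw (?f g) (rcosets H) (rcosets H)"
      by (rule bij_betw_byWitness[where f' = "\<lambda>C. C #> g"])
        (use that PG cl sub in \<open>auto simp: coset_mult_assoc\<close>)
    then show ?thesis by (simp add: Bij_def)
  qed
  have "?f \<in> hom (G\<lparr>carrier := P\<rparr>) (BijGroup (rcosets H))"
  proof (rule homI)
    fix x y assume xy: "x \<in> carrier (G\<lparr>carrier := P\<rparr>)" "y \<in> carrier (G\<lparr>carrier := P\<rparr>)"
    then have "x \<in> P" "y \<in> P" by auto
    then show "?f (x \<otimes>\<^bsub>G\<lparr>carrier := P\<rparr>\<^esub> y) = ?f x \<otimes>\<^bsub>BijGroup (rcosets H)\<^esub> ?f y"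
      using bij PG cl sub
      by (auto simp: BijGroup_def compose_def restrict_def fun_eq_iff coset_mult_assoc inv_mult_group)
  qed (simp add: BijGroup_def bij)
  then show ?thesis
    by (intro group_action.intro group_hom.intro group_hom_axioms.intro P.is_group group_BijGroup)
qed


text \<open>The number of cosets being prime to \<open>p\<close>, some coset \<open>H #> g\<close>
  is fixed by \<open>P\<close>, and \<open>H #> (g \<otimes> x) = H #> g\<close> says that
  \<open>g \<otimes> x \<otimes> inv g\<close> lies in \<open>H\<close>.\<close>

theorem sylow_subconjugate:
  assumes "finite (carrier G)" and H: "subgroup H G" and P: "subgroup P G"
    and "prime p" "card P = p ^ a" "\<not> p dvd card (rcosets H)"
  shows "\<exists>g \<in> carrier G. \<forall>x \<in> P. g \<otimes> x \<otimes> inv g \<in> H"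
proof -
  interpret act: group_action "G\<lparr>carrier := P\<rparr>" "rcosets H" "\<lambda>g. \<lambda>C \<in> rcosets H. C #> inv g"
    using H P by (rule right_mult_action_on_cosets)
  have HG: "H \<subseteq> carrier G" using H subgroup.subset by blast
  have "finite (rcosets H)"
    using assms(1) by (simp add: RCOSETS_def)
  then obtain C where C: "C \<in> rcosets H" "\<And>x. x \<in> P \<Longrightarrow> C #> inv x = C"
    using act.exists_fixed_point[OF assms(4), of a] assms(5,6) by (auto simp: order_def)
  then obtain g where g: "g \<in> carrier G" "C = H #> g" by (auto simp: RCOSETS_def)
  have "g \<otimes> x \<otimes> inv g \<in> H" if x: "x \<in> P" for x
  proof -
    have xG: "x \<in> carrier G" using x P subgroup.mem_carrier by metis
    have "H #> (g \<otimes> x) = H #> g"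
      using C(2)[of "inv x"] x g xG HG subgroup.m_inv_closed[OF P x] by (simp add: coset_mult_assoc)
    moreover have "g \<otimes> x \<in> H #> (g \<otimes> x)"
      using g xG by (intro rcos_self[OF _ H]) auto
    ultimately obtain h where h: "h \<in> H" "g \<otimes> x = h \<otimes> g"
      by (auto simp: r_coset_def)
    moreover have "h \<in> carrier G" using h HG by blast
    ultimately have "g \<otimes> x \<otimes> inv g = h" using g by (simp add: m_assoc)
    then show ?thesis using h by simp
  qed
  then show ?thesis using g by blast
qed

lemma group_hom_conjugation:
  assumes "g \<in> carrier G"
  shows "group_hom G G (\<lambda>x. g \<otimes> x \<otimes> inv g)"
proof -
  have "g \<otimes> (x \<otimes> y) \<otimes> inv g = g \<otimes> x \<otimes> inv g \<otimes> (g \<otimes> y \<otimes> inv g)"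
    if "x \<in> carrier G" "y \<in> carrier G" for x y
    using that assms by (simp add: m_assoc inv_solve_left)
  then show ?thesis
    using assms by (intro group_hom.intro group_hom_axioms.intro is_group homI) auto
qed

text \<open>Take \<open>g\<close> over an element of order \<open>q\<close> of the quotient. Both
  \<open>R\<close> and its conjugate by \<open>g\<close> are Sylow subgroups of \<open>M\<close>, so
  an element \<open>m\<close> of \<open>M\<close> moves the conjugate back into \<open>R\<close>;
  then \<open>m \<otimes> g\<close> normalizes \<open>R\<close>, and so does its power of order
  \<open>q\<close>.\<close>

theorem frattini_prime_order:
  assumes fin: "finite (carrier G)" and M: "M \<lhd> G" and R: "subgroup R G" "R \<subseteq> M"
    and r: "prime r" "card R = r ^ a" "card M = r ^ a * m" "\<not> r dvd m"
    and q: "prime q" "q dvd card (rcosets M)"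
  shows "\<exists>h \<in> carrier G. ord h = q \<and> (\<forall>x \<in> R. h \<otimes> x \<otimes> inv h \<in> R)"
proof -
  interpret M: normal M G by (rule M)
  interpret Q: group "G Mod M" by (rule M.factorgroup_is_group)
  interpret \<pi>: group_hom G "G Mod M" "(#>) M"
    using M.r_coset_hom_Mod by (intro group_hom.intro group_hom_axioms.intro is_group Q.is_group)
  interpret GM: group "G\<lparr>carrier := M\<rparr>" by (rule subgroup_imp_group[OF M.subgroup_axioms])
  have "finite (carrier (G Mod M))" using fin by (simp add: carrier_FactGroup)
  then obtain C where "C \<in> carrier (G Mod M)" "Q.ord C = q"
    using Q.cauchy[OF _ Q.subgroup_self q(1)] q(2) by (auto simp: FactGroup_def)
  then obtain g where g: "g \<in> carrier G" "Q.ord (M #> g) = q"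
    by (auto simp: carrier_FactGroup)
  let ?P = "(\<lambda>x. g \<otimes> x \<otimes> inv g) ` R"
  have RG: "x \<in> carrier G" if "x \<in> R" for x using that R subgroup.mem_carrier by metis
  have finM: "finite M" using fin M.subset finite_subset by blast
  have "subgroup ?P G"
    using group_hom.subgroup_img_is_subgroup[OF group_hom_conjugation[OF g(1)] R(1)] .
  moreover have PM: "?P \<subseteq> M" using R(2) M.inv_op_closed2 g by blast
  ultimately have "subgroup ?P (G\<lparr>carrier := M\<rparr>)"
    by (rule subgroup_incl[OF _ M.subgroup_axioms])
  moreover have "card ?P = r ^ a"
    using r(2) g RG by (subst card_image) (auto intro!: inj_onI)
  moreover have RM: "subgroup R (G\<lparr>carrier := M\<rparr>)"
    using R M.subgroup_axioms by (simp add: subgroup_incl)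
  moreover have "\<not> r dvd card (rcosets\<^bsub>G\<lparr>carrier := M\<rparr>\<^esub> R)"
  proof -
    have "card (rcosets\<^bsub>G\<lparr>carrier := M\<rparr>\<^esub> R) * r ^ a = r ^ a * m"
      using GM.lagrange[OF RM] r by (simp add: order_def)
    then show ?thesis using r(1,4) prime_gt_0_nat[OF r(1)] by simp
  qed
  \<comment> \<open>This \<open>m\<close> is an element of \<open>M\<close> and hides the cofactor
    \<open>m\<close> of the order.\<close>
  ultimately obtain m where m: "m \<in> M" "\<And>y. y \<in> ?P \<Longrightarrow> m \<otimes> y \<otimes> inv m \<in> R"
    using GM.sylow_subconjugate[OF _ RM _ r(1), of ?P a] finM M.subgroup_axioms
    by (auto simp: m_inv_consistent)
  have mG: "m \<in> carrier G" using m M.subset by blast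
  define h where "h = m \<otimes> g"
  have h: "h \<in> carrier G" using mG g by (simp add: h_def)
  have hR: "h \<otimes> x \<otimes> inv h \<in> R" if "x \<in> R" for x
  proof -
    have "h \<otimes> x \<otimes> inv h = m \<otimes> (g \<otimes> x \<otimes> inv g) \<otimes> inv m"
      using mG g RG[OF that] by (simp add: h_def m_assoc inv_mult_group)
    then show ?thesis using m(2) that by auto
  qed
  \<comment> \<open>Since \<open>m\<close> lies in \<open>M\<close>, \<open>h\<close> has the same
    image as \<open>g\<close>, and its order is a multiple of \<open>q\<close>.\<close>
  have "M #> h = M #> g"
    using mG g m(1) M.subset by (simp add: h_def coset_mult_assoc[symmetric] M.rcos_const)
  then have "q dvd ord h" using \<pi>.ord_hom_dvd[OF h] g by simp
  then obtain k where k: "ord (h [^] (k :: nat)) = q" using exists_pow_ord_eq[OF fin h] by blast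
  have "h [^] n \<otimes> x \<otimes> inv (h [^] n) \<in> R" if "x \<in> R" for x and n :: nat
    using that
  proof (induction n arbitrary: x)
    case 0
    then show ?case using RG by simp
  next
    case (Suc n)
    have "h [^] Suc n \<otimes> x \<otimes> inv (h [^] Suc n) = h [^] n \<otimes> (h \<otimes> x \<otimes> inv h) \<otimes> inv (h [^] n)"
      using h RG[OF Suc.prems] by (simp add: m_assoc inv_mult_group)
    then show ?case using Suc.IH[OF hR[OF Suc.prems]] by simp
  qed
  then show ?thesis using k h by blast
qed

end

text \<open>By induction on \<open>A\<close>. It lets a double product be evaluated by rows or by
  columns.\<close>

lemma (in comm_monoid) finprod_swap:
  assumes "finite A" "finite B" "\<And>x y. x \<in> A \<Longrightarrow> y \<in> B \<Longrightarrow> f x y \<in> carrier G"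
  shows "(\<Otimes>x\<in>A. \<Otimes>y\<in>B. f x y) = (\<Otimes>y\<in>B. \<Otimes>x\<in>A. f x y)"
  using assms(1,3)
proof (induction A rule: finite_induct)
  case (insert a A)
  have "(\<Otimes>y\<in>B. \<Otimes>x\<in>insert a A. f x y) = (\<Otimes>y\<in>B. f a y \<otimes> (\<Otimes>x\<in>A. f x y))"
    using insert by (intro finprod_cong') auto
  also have "\<dots> = (\<Otimes>y\<in>B. f a y) \<otimes> (\<Otimes>y\<in>B. \<Otimes>x\<in>A. f x y)"
    using insert by (intro finprod_multf) auto
  also have "\<dots> = (\<Otimes>y\<in>B. f a y) \<otimes> (\<Otimes>x\<in>A. \<Otimes>y\<in>B. f x y)"
    using insert by simp
  also have "\<dots> = (\<Otimes>x\<in>insert a A. \<Otimes>y\<in>B. f x y)"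
    using insert by (intro finprod_insert[symmetric]) auto
  finally show ?case ..
qed simp

section \<open>Fixed-point-free actions and primes in the derived series\<close>

lemma (in group) inv_mult_cancel_left:
  assumes "x \<in> carrier G" "y \<in> carrier G"
  shows "inv x \<otimes> (x \<otimes> y) = y" "x \<otimes> (inv x \<otimes> y) = y"
  using assms by (simp_all flip: m_assoc)

lemma (in group) conj_conj:
  assumes "x \<in> carrier G" "y \<in> carrier G" "u \<in> carrier G"
  shows "x \<otimes> (y \<otimes> u \<otimes> inv y) \<otimes> inv x = (x \<otimes> y) \<otimes> u \<otimes> inv (x \<otimes> y)"
  using assms by (simp add: m_assoc inv_mult_group)

text \<open>Conjugation by \<open>y\<close> is an endomorphism of the abelian group
  \<open>H\<close>, so it passes to each factor.\<close>

lemma (in normal) conj_finprod: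
  assumes comm: "\<And>x y. x \<in> H \<Longrightarrow> y \<in> H \<Longrightarrow> x \<otimes> y = y \<otimes> x"
    and y: "y \<in> carrier G" and f: "\<And>i. i \<in> F \<Longrightarrow> f i \<in> H"
  shows "y \<otimes> finprod (G\<lparr>carrier := H\<rparr>) f F \<otimes> inv y
    = finprod (G\<lparr>carrier := H\<rparr>) (\<lambda>i. y \<otimes> f i \<otimes> inv y) F"
proof -
  interpret A: comm_group "G\<lparr>carrier := H\<rparr>"
    by (rule group.group_comm_groupI[OF subgroup_imp_group]) (use comm in \<open>auto simp: subgroup_axioms\<close>)
  show ?thesis
  proof (cases "finite F")
    case True
    then show ?thesis using f
    proof (induction F rule: finite_induct)
      case empty
      then show ?case using y by simp
    next
      case (insert i F)
      have fH: "finprod (G\<lparr>carrier := H\<rparr>) f F \<in> H"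
        using A.finprod_closed[of f F] insert by auto
      have "finprod (G\<lparr>carrier := H\<rparr>) (\<lambda>i. y \<otimes> f i \<otimes> inv y) (insert i F) =
          (y \<otimes> f i \<otimes> inv y) \<otimes> finprod (G\<lparr>carrier := H\<rparr>) (\<lambda>i. y \<otimes> f i \<otimes> inv y) F"
        using insert y inv_op_closed2 by (subst A.finprod_insert) auto
      also have "\<dots> = (y \<otimes> f i \<otimes> inv y) \<otimes> (y \<otimes> finprod (G\<lparr>carrier := H\<rparr>) f F \<otimes> inv y)"
        using insert by simp
      also have "\<dots> = y \<otimes> (f i \<otimes> finprod (G\<lparr>carrier := H\<rparr>) f F) \<otimes> inv y"
        using group_hom.hom_mult[OF group_hom_conjugation[OF y]] fH insert subset by auto
      also have "f i \<otimes> finprod (G\<lparr>carrier := H\<rparr>) f F = finprod (G\<lparr>carrier := H\<rparr>) f (insert i F)"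
        using insert by (subst A.finprod_insert) auto
      finally show ?case ..
    qed
  \<comment> \<open>An infinite product is 1 by the convention of \<open>finprod\<close>, and
    conjugation fixes 1.\<close>
  qed (use y in \<open>simp add: finprod_def\<close>)
qed

text \<open>If \<open>h\<close> acts on \<open>R\<close>, and the elements of \<open>R\<close> and \<open>h\<close> act on the abelian normal subgroup
  \<open>H\<close>, all without nontrivial fixed points, then the coset \<open>R h\<^sup>i\<close> (\<open>0 < i < q\<close>) consists of the
  conjugates \<open>x h\<^sup>i x\<^sup>-\<^sup>1\<close>. Multiply the images of \<open>v\<close> under all \<open>x h\<^sup>i x\<^sup>-\<^sup>1\<close>: for each fixed \<open>x\<close> the
  partial product is a fixed point of a conjugate of \<open>h\<close>, so the whole product is trivial; for each
  fixed \<open>i > 0\<close> it is a fixed point of \<open>R\<close>, so only the contribution \<open>v\<close> to the power \<open>card R\<close> of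
  \<open>i = 0\<close> survives.\<close>

theorem (in normal) fixed_point_free_pow_card_eq_one:
  fixes q :: nat
  assumes comm: "\<And>x y. x \<in> H \<Longrightarrow> y \<in> H \<Longrightarrow> x \<otimes> y = y \<otimes> x"
    and R: "subgroup R G" "finite R" "R \<noteq> {\<one>}"
    and h: "h \<in> carrier G" "h [^] q = \<one>" "q > 0" "\<And>x. x \<in> R \<Longrightarrow> h \<otimes> x \<otimes> inv h \<in> R"
    and fixR: "\<And>i x. 0 < i \<Longrightarrow> i < q \<Longrightarrow> x \<in> R \<Longrightarrow> x \<otimes> h [^] i = h [^] i \<otimes> x \<Longrightarrow> x = \<one>"
    and fixN: "\<And>x u. x \<in> R \<Longrightarrow> u \<in> H \<Longrightarrow> x \<otimes> u \<otimes> inv x = u \<Longrightarrow> x = \<one> \<or> u = \<one>"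
    and fixh: "\<And>u. u \<in> H \<Longrightarrow> h \<otimes> u \<otimes> inv h = u \<Longrightarrow> u = \<one>"
    and v: "v \<in> H"
  shows "v [^] card R = \<one>"
proof -
  let ?A = "G\<lparr>carrier := H\<rparr>"
  interpret A: comm_group ?A
    by (rule group.group_comm_groupI[OF subgroup_imp_group]) (use comm in \<open>auto simp: subgroup_axioms\<close>)
  interpret R: subgroup R G by (rule R)
  define c where "c y u = y \<otimes> u \<otimes> inv y" for y u
  have RG: "x \<in> carrier G" if "x \<in> R" for x using that by simp
  have HG: "u \<in> carrier G" if "u \<in> H" for u using that by simp
  have hi: "h [^] (i::nat) \<in> carrier G" for i using h by simp
  have cH [simp]: "c y u \<in> H" if "y \<in> carrier G" "u \<in> H" for y u
    using that inv_op_closed2 by (simp add: c_def)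
  have cc: "c x (c y u) = c (x \<otimes> y) u" if "x \<in> carrier G" "y \<in> carrier G" "u \<in> H" for x y u
    using conj_conj[of x y u] that by (simp add: c_def)
  have cprod: "c y (finprod ?A f F) = finprod ?A (\<lambda>i. c y (f i)) F"
    if "y \<in> carrier G" "\<And>i. i \<in> F \<Longrightarrow> f i \<in> H" for y f and F :: "'i set"
    using conj_finprod[OF comm that] by (simp add: c_def)
  \<comment> \<open>A product is fixed by \<open>y\<close> as soon as \<open>y\<close> permutes its
    factors; \<open>s\<close> is that permutation on indices.\<close>
  have fixed: "c y (finprod ?A f F) = finprod ?A f F"
    if "y \<in> carrier G" "\<And>i. i \<in> F \<Longrightarrow> f i \<in> H" "bij_betw s F F" "\<And>i. i \<in> F \<Longrightarrow> c y (f i) = f (s i)"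
    for y f s and F :: "'i set"
  proof -
    have "c y (finprod ?A f F) = finprod ?A (\<lambda>i. f (s i)) F"
      using that bij_betwE[OF that(3)] by (subst cprod) (auto intro!: A.finprod_cong')
    also have "\<dots> = finprod ?A f (s ` F)"
      using that by (intro A.finprod_reindex[symmetric]) (auto simp: bij_betw_def)
    finally show ?thesis using that(3) by (simp add: bij_betw_def)
  qed
  define F where "F x i = c (x \<otimes> h [^] i \<otimes> inv x) v" for x and i :: nat
  have FH: "F x i \<in> H" if "x \<in> R" for x i
    using that v RG hi by (simp add: F_def)
  have row: "finprod ?A (F x) {..<q} = \<one>" if x: "x \<in> R" for x
  proof -
    let ?y = "x \<otimes> h \<otimes> inv x" and ?u = "finprod ?A (F x) {..<q}"
    have uH: "?u \<in> H" using A.finprod_closed[of "F x" "{..<q}"] FH[OF x] by auto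
    have step: "c ?y (F x i) = F x (Suc i)" for i
    proof -
      have "?y \<otimes> (x \<otimes> h [^] i \<otimes> inv x) = x \<otimes> (h \<otimes> h [^] i) \<otimes> inv x"
        using RG[OF x] h(1) by (simp add: m_assoc inv_mult_cancel_left)
      then show ?thesis
        using RG[OF x] h(1) v by (simp add: F_def cc flip: nat_pow_Suc2)
    qed
    have "c ?y ?u = ?u"
    \<comment> \<open>Conjugation by \<open>?y\<close> raises the exponent by one, cyclically:
      exponent \<open>q\<close> is exponent 0 because \<open>h [^] q = \<one>\<close>.\<close>
    proof (rule fixed[of _ _ _ "\<lambda>i. if Suc i = q then 0 else Suc i"])
      show "bij_betw (\<lambda>i. if Suc i = q then 0 else Suc i) {..<q} {..<q}"
        by (rule bij_betw_byWitness[where f' = "\<lambda>i. if i = 0 then q - 1 else i - 1"]) (use h(3) in auto)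
      show "c ?y (F x i) = F x (if Suc i = q then 0 else Suc i)" for i
        using step h(2) by (auto simp: F_def simp del: nat_pow_Suc)
    qed (use RG[OF x] h(1) FH[OF x] in auto)
    \<comment> \<open>Conjugation by \<open>inv x\<close> moves the fixed point of \<open>?y\<close>
      to a fixed point of \<open>h\<close> itself, where \<open>fixh\<close> applies.\<close>
    then have "c (inv x) (c ?y ?u) = c (inv x) ?u" by simp
    moreover have "inv x \<otimes> ?y = h \<otimes> inv x"
      using RG[OF x] h(1) by (simp add: m_assoc[symmetric])
    ultimately have "c h (c (inv x) ?u) = c (inv x) ?u"
      using RG[OF x] h(1) uH by (simp add: cc)
    then have "c (inv x) ?u = \<one>"
      using fixh RG[OF x] uH by (simp add: c_def[of h])
    then have "c x (c (inv x) ?u) = \<one>" using RG[OF x] by (simp add: c_def)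
    then show ?thesis using RG[OF x] uH HG[OF uH] by (simp add: cc) (simp add: c_def)
  qed
  have col: "finprod ?A (\<lambda>x. F x i) R = \<one>" if i: "0 < i" "i < q" for i
  proof -
    let ?k = "h [^] i"
    have hR: "h [^] n \<otimes> x \<otimes> inv (h [^] n) \<in> R" if "x \<in> R" for n :: nat and x
      using that
    proof (induction n arbitrary: x)
      case (Suc n)
      have "h [^] Suc n \<otimes> x \<otimes> inv (h [^] Suc n) = h [^] n \<otimes> (h \<otimes> x \<otimes> inv h) \<otimes> inv (h [^] n)"
        using h(1) RG[OF Suc.prems] by (simp add: m_assoc inv_mult_group)
      then show ?case using Suc.IH[OF h(4)[OF Suc.prems]] by simp
    qed (simp add: RG)
    \<comment> \<open>The commutator \<open>t x\<close> satisfies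
      \<open>t x \<otimes> ?k = x \<otimes> ?k \<otimes> inv x\<close>. By \<open>fixR\<close> the
      map \<open>t\<close> is injective, hence a permutation of \<open>R\<close>, so the conjugates
      of \<open>?k\<close> under \<open>R\<close> exhaust its coset.\<close>
    define t where "t x = x \<otimes> (?k \<otimes> inv x \<otimes> inv ?k)" for x
    have tR: "t x \<in> R" if "x \<in> R" for x using that hR by (simp add: t_def)
    have tk: "t x \<otimes> ?k = x \<otimes> ?k \<otimes> inv x" if "x \<in> R" for x
      using RG[OF that] hi by (simp add: t_def m_assoc)
    have "inj_on t R"
    proof (rule inj_onI)
      fix x y assume xy: "x \<in> R" "y \<in> R" "t x = t y"
      then have eq: "x \<otimes> ?k \<otimes> inv x = y \<otimes> ?k \<otimes> inv y" using tk by metis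
      have "(inv y \<otimes> x) \<otimes> ?k = inv y \<otimes> (x \<otimes> ?k \<otimes> inv x) \<otimes> x"
        using RG xy hi by (simp add: m_assoc)
      also have "\<dots> = ?k \<otimes> (inv y \<otimes> x)"
        unfolding eq using RG[OF xy(1)] RG[OF xy(2)] hi by (simp add: m_assoc[symmetric])
      finally have "inv y \<otimes> x = \<one>" using fixR[OF i, of "inv y \<otimes> x"] xy by simp
      then show "x = y" using RG xy by (metis inv_closed inv_equality inv_inv)
    qed
    then have img: "t ` R = R" using tR R(2) by (intro endo_inj_surj) auto
    have "finprod ?A (\<lambda>x. F x i) R = finprod ?A (\<lambda>x. c (t x) (c ?k v)) R"
      using tk tR RG hi v by (intro A.finprod_cong') (auto simp: F_def cc)
    also have "\<dots> = finprod ?A (\<lambda>x. c x (c ?k v)) (t ` R)"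
      using \<open>inj_on t R\<close> tR RG hi v by (intro A.finprod_reindex[symmetric]) auto
    also have "\<dots> = finprod ?A (\<lambda>x. c x (c ?k v)) R" by (simp add: img)
    finally have eq: "finprod ?A (\<lambda>x. F x i) R = finprod ?A (\<lambda>x. c x (c ?k v)) R" .
    \<comment> \<open>Left translation by one nontrivial \<open>z\<close> permutes the factors, so
      \<open>z\<close> fixes the product and \<open>fixN\<close> makes it trivial.\<close>
    obtain z where z: "z \<in> R" "z \<noteq> \<one>" using R(3) R.one_closed by blast
    let ?u = "finprod ?A (\<lambda>x. c x (c ?k v)) R"
    have uH: "?u \<in> H" using A.finprod_closed[of "\<lambda>x. c x (c ?k v)" R] RG hi v by auto
    have "c z ?u = ?u"
    proof (rule fixed[of _ _ _ "(\<otimes>) z"])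
      show "bij_betw ((\<otimes>) z) R R"
        by (rule bij_betw_byWitness[where f' = "(\<otimes>) (inv z)"])
          (use RG z in \<open>auto simp: m_assoc[symmetric]\<close>)
    qed (use RG z hi v in \<open>auto simp: cc m_assoc\<close>)
    then show ?thesis using fixN[OF z(1) uH] z(2) eq by (simp add: c_def)
  qed
  have vR: "v [^] card R \<in> H"
    using A.nat_pow_closed[of v "card R"] v by (simp flip: nat_pow_consistent)
  have "\<one> = finprod ?A (\<lambda>x. finprod ?A (F x) {..<q}) R"
    using row A.finprod_one_eqI[of R "\<lambda>x. finprod ?A (F x) {..<q}"] by simp
  also have "\<dots> = finprod ?A (\<lambda>i. finprod ?A (\<lambda>x. F x i) R) {..<q}"
    using R(2) FH by (intro A.finprod_swap) auto
  \<comment> \<open>The columns with \<open>0 < i\<close> vanish by \<open>col\<close>; in column 0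
    every factor is \<open>v\<close>.\<close>
  also have "\<dots> = finprod ?A (\<lambda>i. if i = 0 then v [^] card R else \<one>) {..<q}"
  proof (rule A.finprod_cong')
    show "finprod ?A (\<lambda>x. F x i) R = (if i = 0 then v [^] card R else \<one>)" if "i \<in> {..<q}" for i
    proof (cases "i = 0")
      case True
      have "finprod ?A (\<lambda>x. F x 0) R = finprod ?A (\<lambda>x. v) R"
        using RG v HG[OF v] by (intro A.finprod_cong') (auto simp: F_def c_def)
      also have "\<dots> = v [^]\<^bsub>?A\<^esub> card R" using v by (intro A.finprod_const) simp
      finally show ?thesis using True by (simp flip: nat_pow_consistent)
    qed (use col that in auto)
  qed (use vR in auto)
  also have "\<dots> = v [^] card R"
    using A.finprod_singleton[of 0 "{..<q}" "\<lambda>_. v [^] card R"] h(3) vR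
    by (auto cong: if_cong)
  finally show ?thesis ..
qed

context group
begin

text \<open>Powers of \<open>x\<close> and \<open>y\<close> with exact orders \<open>p\<close> and
  \<open>q\<close> still commute.\<close>

lemma exists_ord_mult_primes:
  assumes fin: "finite (carrier G)" and xy: "x \<in> carrier G" "y \<in> carrier G" "x \<otimes> y = y \<otimes> x"
    and pq: "prime p" "prime q" "p \<noteq> q" "p dvd ord x" "q dvd ord y"
  shows "\<exists>z \<in> carrier G. ord z = p * q"
proof -
  obtain k l where kl: "ord (x [^] (k::nat)) = p" "ord (y [^] (l::nat)) = q"
    using exists_pow_ord_eq[OF fin] xy pq by meson
  have "x [^] k \<otimes> y = y \<otimes> x [^] k"
    using xy by (intro group_commutes_pow)
  then have "x [^] k \<otimes> y [^] l = y [^] l \<otimes> x [^] k"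
    using xy group_commutes_pow[of y "x [^] k" l] by simp
  then have "ord (x [^] k \<otimes> y [^] l) = p * q"
    using kl xy pq by (intro ord_mult_commuting_primes) auto
  then show ?thesis using xy by blast
qed

text \<open>Taking powers is multiplicative on commuting elements, and conjugation preserves powers.
  For prime \<open>p\<close> every nontrivial element of this subgroup has order \<open>p\<close>,
  so a fixed one yields an edge at \<open>p\<close>.\<close>

lemma normal_torsion:
  assumes N: "N \<lhd> G" and comm: "\<And>x y. x \<in> N \<Longrightarrow> y \<in> N \<Longrightarrow> x \<otimes> y = y \<otimes> x"
  shows "{u \<in> N. u [^] (p::nat) = \<one>} \<lhd> G"
proof -
  interpret N: normal N G by (rule N)
  have "subgroup {u \<in> N. u [^] p = \<one>} G"
  proof (rule subgroupI)
    fix a b assume ab: "a \<in> {u \<in> N. u [^] p = \<one>}" "b \<in> {u \<in> N. u [^] p = \<one>}"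
    show "a \<otimes> b \<in> {u \<in> N. u [^] p = \<one>}"
      using ab comm pow_mult_distrib[of a b p] by auto
  qed (auto simp: nat_pow_inv intro!: exI[of _ "\<one>"])
  moreover have "g \<otimes> u \<otimes> inv g \<in> {u \<in> N. u [^] p = \<one>}" if "g \<in> carrier G" "u \<in> {u \<in> N. u [^] p = \<one>}" for g u
  proof -
    interpret c: group_hom G G "\<lambda>x. g \<otimes> x \<otimes> inv g" using that by (intro group_hom_conjugation)
    show ?thesis
      using that N.inv_op_closed2 c.hom_nat_pow[of u p] by auto
  qed
  ultimately show ?thesis by (simp add: normal_inv_iff)
qed

text \<open>Take a Sylow \<open>r\<close>-subgroup \<open>R\<close> of \<open>M\<close>, an element
  \<open>h\<close> of order \<open>q\<close> normalizing it, and the \<open>p\<close>-torsion of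
  \<open>N\<close>. A nontrivial fixed point of any of the actions would give commuting elements and
  so an excluded order. Hence the power \<open>card R\<close> of an element of order
  \<open>p\<close> is trivial, although \<open>card R\<close> is a power of
  \<open>r\<close>.\<close>

lemma three_primes_chain_contradiction:
  assumes fin: "finite (carrier G)" and N: "N \<lhd> G" and M: "M \<lhd> G"
    and comm: "\<And>x y. x \<in> N \<Longrightarrow> y \<in> N \<Longrightarrow> x \<otimes> y = y \<otimes> x"
    and primes: "prime p" "prime q" "prime r" "p \<noteq> q" "p \<noteq> r" "q \<noteq> r"
    and dvd: "p dvd card N" "r dvd card M" "q dvd card (rcosets M)"
    and no: "\<And>x. x \<in> carrier G \<Longrightarrow> ord x \<noteq> p * q \<and> ord x \<noteq> p * r \<and> ord x \<noteq> q * r"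
  shows False
proof -
  interpret N: normal N G by (rule N)
  interpret M: normal M G by (rule M)
  interpret GM: group "G\<lparr>carrier := M\<rparr>" by (rule subgroup_imp_group[OF M.subgroup_axioms])
  have finM: "finite M" using fin M.subset finite_subset by blast
  have "card M \<noteq> 0" using finM M.one_closed by (metis card_0_eq empty_iff)
  have "\<not> is_unit r" using primes(3) by auto
  define a where "a = multiplicity r (card M)"
  obtain m where m: "card M = r ^ a * m" "\<not> r dvd m"
    using multiplicity_decompose'[of "card M" r] \<open>card M \<noteq> 0\<close> \<open>\<not> is_unit r\<close> unfolding a_def by metis
  have "a \<noteq> 0"
    using m dvd(2) by (metis mult_1 power_0)
  obtain R where R': "subgroup R (G\<lparr>carrier := M\<rparr>)" "card R = r ^ a"
    using sylow_thm[OF primes(3) GM.is_group, of a m] m finM by (auto simp: order_def)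
  have R: "subgroup R G" "R \<subseteq> M"
    using R' M.subgroup_axioms incl_subgroup subgroup.subset[OF R'(1)] by auto
  have finR: "finite R" using R finM finite_subset by blast
  have "1 < r ^ a" using \<open>a \<noteq> 0\<close> prime_gt_1_nat[OF primes(3)]
    by (intro one_less_power) auto
  then have "R \<noteq> {\<one>}" using R'(2) by auto
  interpret R: subgroup R G by (rule R)
  obtain h where h: "h \<in> carrier G" "ord h = q" "\<And>x. x \<in> R \<Longrightarrow> h \<otimes> x \<otimes> inv h \<in> R"
    using frattini_prime_order[OF fin M R primes(3) R'(2) m primes(2) dvd(3)] by blast
  obtain v where v: "v \<in> N" "ord v = p"
    using cauchy[OF fin N.subgroup_axioms primes(1) dvd(1)] by blast
  have ordR: "r dvd ord x" if "x \<in> R" "x \<noteq> \<one>" for x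
  proof -
    have "ord x dvd r ^ a" using ord_dvd_card_subgroup[OF R(1) finR that(1)] R' by simp
    moreover have "ord x \<noteq> 1" using that ord_eq_1 by simp
    ultimately show ?thesis
      using primes(3) divides_primepow_nat[of r "ord x" a] by (metis dvd_power gr0I power_0)
  qed
  let ?T = "{u \<in> N. u [^] p = \<one>}"
  have T: "?T \<lhd> G" by (rule normal_torsion[OF N comm])
  have ordT: "ord u = p" if "u \<in> ?T" "u \<noteq> \<one>" for u
    using that primes by (intro ord_eqI_prime) auto
  have hq: "h [^] q = \<one>" using h by (metis pow_ord_eq_1)
  have conjD: "x \<otimes> u = u \<otimes> x" if "x \<in> carrier G" "u \<in> carrier G" "x \<otimes> u \<otimes> inv x = u" for x u
    using that by (metis inv_solve_right m_closed)
  have "v [^] card R = \<one>"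
  proof (rule normal.fixed_point_free_pow_card_eq_one[OF T _ R(1) finR \<open>R \<noteq> {\<one>}\<close> h(1) hq])
    show "x \<otimes> y = y \<otimes> x" if "x \<in> ?T" "y \<in> ?T" for x y using that comm by blast
    show "0 < q" using primes by (simp add: prime_gt_0_nat)
    show "h \<otimes> x \<otimes> inv h \<in> R" if "x \<in> R" for x using h that by blast
    \<comment> \<open>For \<open>0 < i < q\<close> the power \<open>h [^] i\<close> still has order
      \<open>q\<close>, since \<open>q\<close> is prime.\<close>
    show "x = \<one>" if i: "0 < i" "i < q" "x \<in> R" "x \<otimes> h [^] i = h [^] i \<otimes> x" for i x
    proof (rule ccontr)
      assume "x \<noteq> \<one>"
      have "h [^] i \<noteq> \<one>" using i h pow_eq_id by (auto dest: dvd_imp_le)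
      moreover have "(h [^] i) [^] q = \<one>" using h hq by (metis mult.commute nat_pow_pow nat_pow_one)
      ultimately have "ord (h [^] i) = q" using h primes by (intro ord_eqI_prime) auto
      then obtain z where "z \<in> carrier G" "ord z = q * r"
        using exists_ord_mult_primes[OF fin, of "h [^] i" x q r] i(3,4) h(1) primes ordR[OF i(3) \<open>x \<noteq> \<one>\<close>]
        by auto
      then show False using no by blast
    qed
    show "x = \<one> \<or> u = \<one>" if xu: "x \<in> R" "u \<in> ?T" "x \<otimes> u \<otimes> inv x = u" for x u
    proof (rule ccontr)
      assume "\<not> ?thesis"
      then have "x \<noteq> \<one>" "u \<noteq> \<one>" by auto
      then obtain z where "z \<in> carrier G" "ord z = p * r"
        using exists_ord_mult_primes[OF fin, of u x p r] conjD[of x u] xu primes ordR[of x] ordT[of u]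
        by auto
      then show False using no by blast
    qed
    show "u = \<one>" if u: "u \<in> ?T" "h \<otimes> u \<otimes> inv h = u" for u
    proof (rule ccontr)
      assume "u \<noteq> \<one>"
      then obtain z where "z \<in> carrier G" "ord z = p * q"
        using exists_ord_mult_primes[OF fin, of u h p q] conjD[of h u] u primes h ordT[of u]
        by auto
      then show False using no by blast
    qed
    show "v \<in> ?T" using v by (metis (mono_tags, lifting) N.mem_carrier mem_Collect_eq pow_ord_eq_1)
  qed
  then have "p dvd r ^ a" using v R'(2) pow_eq_id by auto
  then show False using primes prime_dvd_power primes_dvd_imp_eq by blast
qed

section \<open>Factors of the derived series\<close>

lemma card_image_FactGroup:
  assumes "finite (carrier G)" and K: "K \<lhd> G" and L: "subgroup L G" "K \<subseteq> L"
  shows "card ((#>) K ` L) * card K = card L"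
proof -
  interpret K: normal K G by (rule K)
  interpret L: group "G\<lparr>carrier := L\<rparr>" by (rule subgroup_imp_group[OF L(1)])
  have "subgroup K (G\<lparr>carrier := L\<rparr>)" using K.subgroup_axioms L by (simp add: subgroup_incl)
  \<comment> \<open>The cosets of \<open>K\<close> formed inside \<open>L\<close> are the images of
    the elements of \<open>L\<close> in the quotient, so Lagrange's theorem in \<open>L\<close>
    counts them.\<close>
  moreover have "rcosets\<^bsub>G\<lparr>carrier := L\<rparr>\<^esub> K = (#>) K ` L"
    by (auto simp: RCOSETS_def r_coset_def)
  ultimately show ?thesis using L.lagrange by (fastforce simp: order_def)
qed

lemma normal_image_FactGroup:
  assumes K: "K \<lhd> G" and L: "L \<lhd> G"
  shows "(#>) K ` L \<lhd> G Mod K"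
proof -
  interpret K: normal K G by (rule K)
  interpret Q: group "G Mod K" by (rule K.factorgroup_is_group)
  interpret f: group_hom G "G Mod K" "(#>) K"
    using K.r_coset_hom_Mod by (intro group_hom.intro group_hom_axioms.intro is_group Q.is_group)
  show ?thesis
    by (rule normal.surj_hom_normal_subgroup[OF L f.group_hom_axioms]) (simp add: carrier_FactGroup)
qed

end

lemma (in group) derived_series_normal: "(derived G ^^ n) (carrier G) \<lhd> G"
proof (induction n)
  case 0
  show ?case using subgroup_self by (auto simp: normal_inv_iff)
next
  case (Suc n)
  then show ?case by (simp add: derived_is_normal)
qed

lemma (in group) derived_series_antimono:
  assumes "m \<le> n"
  shows "(derived G ^^ n) (carrier G) \<subseteq> (derived G ^^ m) (carrier G)"
  using assms
proof (induction rule: dec_induct)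
  case (step n)
  have "(derived G ^^ Suc n) (carrier G) \<subseteq> (derived G ^^ n) (carrier G)"
    using derived_incl[OF subset_refl] derived_series_normal[of n] by (simp add: normal_def)
  then show ?case using step by blast
qed simp

context group
begin

text \<open>The commutator of two representatives lies in \<open>derived G L\<close>, hence in
  \<open>K\<close>, so both products give the same coset.\<close>

lemma FactGroup_commute:
  assumes "K \<lhd> G" "subgroup L G" "derived G L \<subseteq> K" "x \<in> (#>) K ` L" "y \<in> (#>) K ` L"
  shows "x \<otimes>\<^bsub>G Mod K\<^esub> y = y \<otimes>\<^bsub>G Mod K\<^esub> x"
proof -
  interpret K: normal K G by (rule assms)
  obtain a b where ab: "a \<in> L" "x = K #> a" "b \<in> L" "y = K #> b" using assms by blast
  have abG: "a \<in> carrier G" "b \<in> carrier G" using ab assms(2) subgroup.mem_carrier by metis+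
  have "a \<otimes> b \<otimes> inv a \<otimes> inv b \<in> derived G L"
    using ab by (auto simp: derived_def intro!: generate.incl)
  then have "K #> (a \<otimes> b \<otimes> inv a \<otimes> inv b) = K"
    using assms(3) by (intro K.rcos_const[OF is_group]) blast
  then have "K #> (a \<otimes> b \<otimes> inv a \<otimes> inv b \<otimes> (b \<otimes> a)) = K #> (b \<otimes> a)"
    using abG K.subset by (simp flip: coset_mult_assoc)
  then have "K #> (a \<otimes> b) = K #> (b \<otimes> a)"
    using abG by (simp add: m_assoc inv_mult_cancel_left)
  then show ?thesis using ab abG by (simp add: K.rcos_sum)
qed

text \<open>Dividing by \<open>D (Suc k)\<close> makes the image of \<open>D k\<close> abelian. The
  quotient keeps \<open>p\<close> in the order of this image, \<open>r\<close> in the order of the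
  image of \<open>D j\<close>, and \<open>q\<close> in the index of the latter: the setting of
  \<open>three_primes_chain_contradiction\<close>.\<close>

lemma no_three_primes_ordered:
  fixes D
  defines "D \<equiv> \<lambda>n. (derived G ^^ n) (carrier G)"
  assumes fin: "finite (carrier G)"
    and primes: "prime p" "prime q" "prime r" "p \<noteq> q" "p \<noteq> r" "q \<noteq> r"
    and dvd: "p dvd card (D k)" "\<not> p dvd card (D (Suc k))"
      "r dvd card (D j)" "\<not> r dvd card (D (Suc j))"
      "q dvd order G" "\<not> q dvd card (D j)"
    and no: "\<And>x. x \<in> carrier G \<Longrightarrow> ord x \<noteq> p * q \<and> ord x \<noteq> p * r \<and> ord x \<noteq> q * r"
    and jk: "j < k"
  shows False
proof -
  let ?K = "D (Suc k)"
  have D: "D n \<lhd> G" for n unfolding D_def by (rule derived_series_normal)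
  have sub: "subgroup (D n) G" for n using D normal_imp_subgroup by blast
  have le: "D n \<subseteq> D m" if "m \<le> n" for m n using that unfolding D_def by (rule derived_series_antimono)
  interpret K: normal ?K G by (rule D)
  interpret Q: group "G Mod ?K" by (rule K.factorgroup_is_group)
  interpret f: group_hom G "G Mod ?K" "(#>) ?K"
    using K.r_coset_hom_Mod by (intro group_hom.intro group_hom_axioms.intro is_group Q.is_group)
  have finQ: "finite (carrier (G Mod ?K))" using fin by (simp add: carrier_FactGroup)
  have card: "card ((#>) ?K ` D n) * card ?K = card (D n)" if "n \<le> Suc k" for n
    using card_image_FactGroup[OF fin D sub le[OF that]] .
  let ?N = "(#>) ?K ` D k" and ?M = "(#>) ?K ` D j"
  have fD: "finite (D n)" for n using sub fin subgroup.subset finite_subset by metis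
  have cdvd: "card (D n) dvd card (D m)" if "m \<le> n" for m n
  proof -
    have "card ((#>) (D n) ` D m) * card (D n) = card (D m)"
      using card_image_FactGroup[OF fin D sub le[OF that]] .
    then show ?thesis by (metis dvd_triv_right)
  qed
  have N: "?N \<lhd> G Mod ?K" and M: "?M \<lhd> G Mod ?K"
    using normal_image_FactGroup D by blast+
  have comm: "x \<otimes>\<^bsub>G Mod ?K\<^esub> y = y \<otimes>\<^bsub>G Mod ?K\<^esub> x" if "x \<in> ?N" "y \<in> ?N" for x y
    using FactGroup_commute[OF D sub _ that] by (simp add: D_def)
  \<comment> \<open>As \<open>j < k\<close>, \<open>D (Suc k)\<close> lies in
    \<open>D (Suc j)\<close>, whose order is prime to \<open>r\<close>; the factor \<open>r\<close>
    of \<open>card (D j)\<close> therefore survives in the quotient.\<close>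
  have "\<not> r dvd card ?K"
    using cdvd[of "Suc j" "Suc k"] jk dvd(4) dvd_trans by (metis Suc_le_mono less_imp_le)
  then have "r dvd card ?M"
    using card[of j] jk dvd(3) primes(3) prime_dvd_mult_iff[OF primes(3)] by (metis le_SucI less_imp_le)
  moreover have "p dvd card ?N"
    using card[of k] dvd(1,2) prime_dvd_mult_iff[OF primes(1)] by (metis le_SucI order_refl)
  moreover have "q dvd card (rcosets\<^bsub>G Mod ?K\<^esub> ?M)"
  proof -
    have "card (rcosets\<^bsub>G Mod ?K\<^esub> ?M) * card ?M = order (G Mod ?K)"
      using Q.lagrange M normal_imp_subgroup by blast
    moreover have "order (G Mod ?K) * card ?K = order G"
      using card_image_FactGroup[OF fin D subgroup_self K.subset]
      by (simp add: order_def carrier_FactGroup)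
    ultimately have "card (rcosets\<^bsub>G Mod ?K\<^esub> ?M) * card (D j) = order G"
      using card[of j] jk by (metis le_SucI less_imp_le mult.assoc)
    then show ?thesis using dvd(5,6) prime_dvd_mult_iff[OF primes(2)] by metis
  qed
  \<comment> \<open>An element of an excluded order in the quotient would lift to one of the same
    order in the group.\<close>
  moreover have "Q.ord x \<noteq> p * q \<and> Q.ord x \<noteq> p * r \<and> Q.ord x \<noteq> q * r"
    if x: "x \<in> carrier (G Mod ?K)" for x
  proof -
    obtain g where "g \<in> carrier G" "x = ?K #> g" using x by (auto simp: carrier_FactGroup)
    then obtain y where "y \<in> carrier G" "ord y = Q.ord x" using f.exists_ord_lift[OF fin] by blast
    then show ?thesis using no by metis
  qed
  ultimately show False
    using Q.three_primes_chain_contradiction[OF finQ N M comm primes] by blast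
qed

text \<open>Both primes divide the order of the abelian quotient of \<open>D k\<close> by
  \<open>D (Suc k)\<close>; there elements of orders \<open>p\<close> and \<open>q\<close> commute,
  and their product lifts.\<close>

lemma no_two_primes_same_factor:
  fixes D
  defines "D \<equiv> \<lambda>n. (derived G ^^ n) (carrier G)"
  assumes fin: "finite (carrier G)" and primes: "prime p" "prime q" "p \<noteq> q"
    and dvd: "p dvd card (D k)" "\<not> p dvd card (D (Suc k))" "q dvd card (D k)" "\<not> q dvd card (D (Suc k))"
  shows "\<exists>x \<in> carrier G. ord x = p * q"
proof -
  let ?K = "D (Suc k)"
  have D: "D n \<lhd> G" for n unfolding D_def by (rule derived_series_normal)
  have sub: "subgroup (D n) G" for n using D normal_imp_subgroup by blast
  have le: "?K \<subseteq> D k" unfolding D_def by (rule derived_series_antimono) simp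
  interpret K: normal ?K G by (rule D)
  interpret Q: group "G Mod ?K" by (rule K.factorgroup_is_group)
  interpret f: group_hom G "G Mod ?K" "(#>) ?K"
    using K.r_coset_hom_Mod by (intro group_hom.intro group_hom_axioms.intro is_group Q.is_group)
  have finQ: "finite (carrier (G Mod ?K))" using fin by (simp add: carrier_FactGroup)
  let ?N = "(#>) ?K ` D k"
  have N: "subgroup ?N (G Mod ?K)" using f.subgroup_img_is_subgroup[OF sub] .
  have "card ?N * card ?K = card (D k)" by (rule card_image_FactGroup[OF fin D sub le])
  then have "p dvd card ?N" "q dvd card ?N"
    using dvd prime_dvd_mult_iff primes by metis+
  then obtain x y where xy: "x \<in> ?N" "Q.ord x = p" "y \<in> ?N" "Q.ord y = q"
    using Q.cauchy[OF finQ N] primes by metis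
  then have xyQ: "x \<in> carrier (G Mod ?K)" "y \<in> carrier (G Mod ?K)"
    using N subgroup.mem_carrier by metis+
  moreover have "x \<otimes>\<^bsub>G Mod ?K\<^esub> y = y \<otimes>\<^bsub>G Mod ?K\<^esub> x"
    using FactGroup_commute[OF D sub _ xy(1,3)] by (simp add: D_def)
  ultimately obtain z where z: "z \<in> carrier (G Mod ?K)" "Q.ord z = p * q"
    using Q.exists_ord_mult_primes[OF finQ, of x y p q] xy primes by auto
  then obtain g where "g \<in> carrier G" "z = ?K #> g" by (auto simp: carrier_FactGroup)
  then show ?thesis using f.exists_ord_lift[OF fin] z by metis
qed

text \<open>Sort the primes by the step at which they leave the orders along the derived series. A
  tie produces an edge by \<open>no_two_primes_same_factor\<close>, and three different steps
  contradict \<open>no_three_primes_ordered\<close>.\<close>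

theorem solvable_three_primes:
  assumes fin: "finite (carrier G)" and solv: "solvable G"
    and primes: "prime p" "prime q" "prime r" "p \<noteq> q" "p \<noteq> r" "q \<noteq> r"
    and dvd: "p dvd order G" "q dvd order G" "r dvd order G"
  shows "\<exists>x \<in> carrier G. ord x = p * q \<or> ord x = p * r \<or> ord x = q * r"
proof (rule ccontr)
  assume "\<not> ?thesis"
  then have no: "ord x \<noteq> p * q" "ord x \<noteq> p * r" "ord x \<noteq> q * r"
    "ord x \<noteq> q * p" "ord x \<noteq> r * p" "ord x \<noteq> r * q" if "x \<in> carrier G" for x
    using that by (auto simp: mult.commute)
  define D where "D n = (derived G ^^ n) (carrier G)" for n
  obtain l where l: "D l = {\<one>}"
    using solv solvable_iff_trivial_derived_seq by (auto simp: D_def)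
  \<comment> \<open>\<open>i s\<close> is the index of the last term of the series whose order
    \<open>s\<close> divides.\<close>
  define i where "i s = (LEAST n. \<not> s dvd card (D (Suc n)))" for s
  have le: "D n \<subseteq> D m" if "m \<le> n" for m n using that unfolding D_def by (rule derived_series_antimono)
  have sub: "subgroup (D n) G" for n
    using derived_series_normal normal_imp_subgroup by (auto simp: D_def)
  have i: "s dvd card (D (i s))" "\<not> s dvd card (D (Suc (i s)))" if s: "prime s" "s dvd order G" for s
  proof -
    have "D (Suc l) = {\<one>}" using le[of l "Suc l"] l subgroup.one_closed[OF sub[of "Suc l"]] by auto
    then have "\<not> s dvd card (D (Suc l))" using s by auto
    then show "\<not> s dvd card (D (Suc (i s)))" unfolding i_def by (rule LeastI)
    show "s dvd card (D (i s))"
    proof (cases "i s")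
      case 0
      then show ?thesis using s by (simp add: D_def order_def)
    next
      case (Suc n)
      then have "n < (LEAST n. \<not> s dvd card (D (Suc n)))" by (simp add: i_def)
      then have "s dvd card (D (Suc n))" using not_less_Least by blast
      then show ?thesis using Suc by simp
    qed
  qed
  have i_less: "\<not> s dvd card (D n)" if s: "prime s" "s dvd order G" and n: "i s < n" for s n
  proof -
    have "card ((#>) (D n) ` D (Suc (i s))) * card (D n) = card (D (Suc (i s)))"
      using card_image_FactGroup[OF fin _ sub le[of "Suc (i s)" n]] derived_series_normal n by (simp add: D_def)
    then show ?thesis using i(2)[OF s] by (metis dvd_mult)
  qed
  have ne: "i s \<noteq> i t" if "prime s" "prime t" "s \<noteq> t" "s dvd order G" "t dvd order G"
    "\<And>x. x \<in> carrier G \<Longrightarrow> ord x \<noteq> s * t" for s t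
    using no_two_primes_same_factor[OF fin that(1-3), of "i s"] i[OF that(1,4)] i[OF that(2,5)] that(6)
    unfolding D_def by metis
  \<comment> \<open>Here \<open>t\<close> leaves first, then \<open>u\<close>, and \<open>s\<close>
    last.\<close>
  have ordered: False
    if "prime s" "prime t" "prime u" "s \<noteq> t" "s \<noteq> u" "t \<noteq> u" "s dvd order G" "t dvd order G" "u dvd order G"
      "\<And>x. x \<in> carrier G \<Longrightarrow> ord x \<noteq> s * t \<and> ord x \<noteq> s * u \<and> ord x \<noteq> t * u"
      "i t < i u" "i u < i s" for s t u
    using no_three_primes_ordered[OF fin that(1-6), of "i s" "i u", folded D_def, OF
        i[OF that(1,7)] i[OF that(3,9)] that(8) i_less[OF that(2,8,11)] that(10,12)] .
  have "i p \<noteq> i q" "i p \<noteq> i r" "i q \<noteq> i r"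
    using ne[of p q] ne[of p r] ne[of q r] primes dvd no by blast+
  then have "i p < i q \<and> i q < i r \<or> i p < i r \<and> i r < i q \<or> i q < i p \<and> i p < i r
    \<or> i q < i r \<and> i r < i p \<or> i r < i p \<and> i p < i q \<or> i r < i q \<and> i q < i p"
    by linarith
  then consider "i p < i q" "i q < i r" | "i p < i r" "i r < i q" | "i q < i p" "i p < i r"
    | "i q < i r" "i r < i p" | "i r < i p" "i p < i q" | "i r < i q" "i q < i p"
    by blast
  then show False
  proof cases
    case 1
    show False by (rule ordered[of r p q]) (simp_all add: primes primes(4-6)[symmetric] dvd no 1)
  next
    case 2
    show False by (rule ordered[of q p r]) (simp_all add: primes primes(4-6)[symmetric] dvd no 2)
  next
    case 3
    show False by (rule ordered[of r q p]) (simp_all add: primes primes(4-6)[symmetric] dvd no 3)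
  next
    case 4
    show False by (rule ordered[of p q r]) (simp_all add: primes primes(4-6)[symmetric] dvd no 4)
  next
    case 5
    show False by (rule ordered[of q r p]) (simp_all add: primes primes(4-6)[symmetric] dvd no 5)
  next
    case 6
    show False by (rule ordered[of p r q]) (simp_all add: primes primes(4-6)[symmetric] dvd no 6)
  qed
qed
end

section \<open>Small triangle-free graphs\<close>

lemma pair_graph_iff:
  "pair_graph F \<longleftrightarrow> finite (pverts F) \<and> parcs F \<subseteq> pverts F \<times> pverts F \<and>
     (\<forall>u v. (u, v) \<in> parcs F \<longrightarrow> (v, u) \<in> parcs F) \<and> (\<forall>u. (u, u) \<notin> parcs F)"
  (is "?L \<longleftrightarrow> ?R")
proof
  assume ?L
  then interpret pair_graph F .
  show ?R
    using pair_finite_verts pair_sym_arcs pair_no_loops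
    by (auto simp: symmetric_def sym_def dest: in_arcsD1 in_arcsD2) fastforce
next
  assume R: ?R
  then have "finite (parcs F)" using finite_subset by (metis finite_cartesian_product)
  with R show ?L
    by unfold_locales (auto simp: symmetric_def sym_def)
qed

definition triangle_free :: "'a pair_pre_digraph \<Rightarrow> bool" where
  "triangle_free F \<longleftrightarrow> \<not> (\<exists>a b c. (a, b) \<in> parcs F \<and> (b, c) \<in> parcs F \<and> (c, a) \<in> parcs F)"

lemma ucycleI:
  assumes "pair_graph F" "3 \<le> length p" "set p \<subseteq> parcs F" "pcas u p u" "distinct (tl (pawalk_verts u p))"
  shows "ucycle (with_proj F) p"
proof -
  have "u \<in> pverts F" using assms by (cases p) (auto simp: pair_graph_iff)
  then show ?thesis
    using assms
    by (auto simp: ucycle_def pre_digraph.cycle_def pre_digraph.awalk_def cas_with_proj_eq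
        awalk_verts_with_proj_eq)
qed

lemma ucycleE:
  assumes "ucycle (with_proj F) p"
  obtains u where "3 \<le> length p" "set p \<subseteq> parcs F" "pcas u p u" "distinct (tl (pawalk_verts u p))"
  using assms
  by (auto simp: ucycle_def pre_digraph.cycle_def pre_digraph.awalk_def cas_with_proj_eq
      awalk_verts_with_proj_eq)

text \<open>Three arcs closing up would form a triangle, and \<open>ucycle\<close> already excludes
  fewer.\<close>

lemma ucycle_length_ge_4:
  assumes "triangle_free F" "ucycle (with_proj F) p"
  shows "4 \<le> length p"
proof (rule ccontr)
  assume "\<not> 4 \<le> length p"
  obtain u where u: "3 \<le> length p" "set p \<subseteq> parcs F" "pcas u p u" using assms(2) by (rule ucycleE)
  then have "length p = Suc (Suc (Suc 0))" using \<open>\<not> 4 \<le> length p\<close> by simp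
  then obtain e1 e2 e3 where "p = [e1, e2, e3]" by (auto simp: length_Suc_conv)
  then obtain b c where "p = [(u, b), (b, c), (c, u)]"
    using u(3) by (cases e1; cases e2; cases e3) simp
  then have "(u, b) \<in> parcs F" "(b, c) \<in> parcs F" "(c, u) \<in> parcs F" using u(2) by simp_all
  then show False using assms(1) unfolding triangle_free_def by blast
qed

lemma triangle_ucycle:
  assumes "pair_graph F" "(a, b) \<in> parcs F" "(b, c) \<in> parcs F" "(c, a) \<in> parcs F"
  shows "ucycle (with_proj F) [(a, b), (b, c), (c, a)]"
  using assms by (intro ucycleI[where u = a]) (auto simp: pair_graph_iff)

lemma girth_eq_3_iff:
  assumes "pair_graph F"
  shows "girth (with_proj F) = 3 \<longleftrightarrow> \<not> triangle_free F"
proof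
  assume "\<not> triangle_free F"
  then obtain a b c where "(a, b) \<in> parcs F" "(b, c) \<in> parcs F" "(c, a) \<in> parcs F"
    by (auto simp: triangle_free_def)
  then have "ucycle (with_proj F) [(a, b), (b, c), (c, a)]"
    using assms by (rule triangle_ucycle[rotated])
  then have "girth (with_proj F) \<le> enat 3"
    unfolding girth_def by (intro INF_lower2) auto
  moreover have "enat 3 \<le> girth (with_proj F)"
    unfolding girth_def by (intro INF_greatest) (auto simp: ucycle_def)
  ultimately show "girth (with_proj F) = 3" by (simp add: numeral_eq_enat)
next
  assume girth: "girth (with_proj F) = 3"
  show "\<not> triangle_free F"
  proof
    assume "triangle_free F"
    then have "enat 4 \<le> girth (with_proj F)"
      unfolding girth_def by (intro INF_greatest) (auto dest: ucycle_length_ge_4)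
    then show False using girth by (simp add: numeral_eq_enat)
  qed
qed

text \<open>Without triangles a cycle has at least four edges, and every edge contributes two arcs.
  Thus counting arcs suffices to recognize the small forests.\<close>

lemma uforest_if_few_arcs:
  assumes F: "pair_graph F" "triangle_free F" "card (parcs F) < 8"
  shows "uforest (with_proj F)"
  unfolding uforest_def
proof
  assume "\<exists>p. ucycle (with_proj F) p"
  then obtain p where p: "ucycle (with_proj F) p" ..
  obtain u where u: "set p \<subseteq> parcs F" "pcas u p u" "distinct (tl (pawalk_verts u p))"
    using p by (rule ucycleE)
  have "4 \<le> length p" using F(2) p by (rule ucycle_length_ge_4)
  then obtain k where "length p = 4 + k" using le_Suc_ex by blast
  then have "length p = Suc (Suc (Suc (Suc k)))" by simp
  then obtain e1 e2 e3 e4 q where "p = e1 # e2 # e3 # e4 # q" by (auto simp: length_Suc_conv)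
  \<comment> \<open>Only the first four arcs are examined. The end \<open>e\<close> of the fourth
    may coincide with the start \<open>u\<close>, so \<open>ne\<close> does not separate these
    two.\<close>
  then obtain b c d e where p_eq: "p = (u, b) # (b, c) # (c, d) # (d, e) # q"
    using u(2) by (cases e1; cases e2; cases e3; cases e4) auto
  have last: "v \<in> set (pawalk_verts w q)" if "pcas w q v" for w v q
    using that by (induction q arbitrary: w) auto
  have "u \<in> set (pawalk_verts e q)" using u(2) p_eq last[of e q u] by simp
  moreover have "distinct (b # c # d # pawalk_verts e q)" using u(3) p_eq by simp
  moreover have "e \<in> set (pawalk_verts e q)" by (cases q) (use u(2) p_eq in auto)
  ultimately have ne: "u \<noteq> b" "u \<noteq> c" "u \<noteq> d" "b \<noteq> c" "b \<noteq> d" "c \<noteq> d" "b \<noteq> e" "c \<noteq> e" "d \<noteq> e" by auto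
  have "{(u, b), (b, c), (c, d), (d, e), (b, u), (c, b), (d, c), (e, d)} \<subseteq> parcs F" (is "?S \<subseteq> _")
    using u(1) p_eq F(1) by (auto simp: pair_graph_iff)
  moreover have "finite (parcs F)"
    using F(1) finite_subset by (auto simp: pair_graph_iff)
  ultimately have "card ?S \<le> card (parcs F)" by (intro card_mono)
  moreover have "card ?S = 8" using ne by (auto simp: card_insert_if)
  ultimately show False using F(3) by simp
qed

lemma digraph_isoI:
  assumes F: "pair_graph F" and "pair_graph H"
    and "inj_on f (pverts F)" "f ` pverts F = pverts H"
    and arcs: "\<And>u v. u \<in> pverts F \<Longrightarrow> v \<in> pverts F \<Longrightarrow> (u, v) \<in> parcs F \<longleftrightarrow> (f u, f v) \<in> parcs H"
  shows "digraph_iso (with_proj F) (with_proj H)"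
proof -
  let ?h = "\<lparr>iso_verts = f, iso_arcs = map_prod f f, iso_head = snd, iso_tail = fst\<rparr>"
  interpret F: pair_graph F by (rule F)
  have E: "parcs F \<subseteq> pverts F \<times> pverts F" "parcs H \<subseteq> pverts H \<times> pverts H"
    using assms(1,2) by (auto simp: pair_graph_iff)
  have "inj_on (map_prod f f) (parcs F)"
    using inj_on_subset[OF map_prod_inj_on[OF assms(3,3)] E(1)] .
  then have "pre_digraph.digraph_isomorphism (with_proj F) ?h"
    using assms(3) F.wf_digraph_axioms by (auto simp: pre_digraph.digraph_isomorphism_def)
  moreover have "map_prod f f ` parcs F = parcs H"
  proof
    show "map_prod f f ` parcs F \<subseteq> parcs H" using E arcs by fastforce
    show "parcs H \<subseteq> map_prod f f ` parcs F"
    proof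
      fix x assume x: "x \<in> parcs H"
      then obtain u v where "x = (f u, f v)" "u \<in> pverts F" "v \<in> pverts F"
        using E(2) assms(4) by blast
      then show "x \<in> map_prod f f ` parcs F" using arcs x by (auto intro!: rev_image_eqI[of "(u, v)"])
    qed
  qed
  then have "with_proj H = app_iso ?h (with_proj F)"
    using assms(4) by (simp add: app_iso_def with_proj_def)
  ultimately show ?thesis unfolding digraph_iso_def by blast
qed

lemma digraph_isoE:
  assumes "digraph_iso (with_proj F) (with_proj H)"
  obtains f where "inj_on f (pverts F)" "pverts H = f ` pverts F" "parcs H = map_prod f f ` parcs F"
proof -
  obtain h where h: "pre_digraph.digraph_isomorphism (with_proj F) h" "with_proj H = app_iso h (with_proj F)"
    using assms by (auto simp: digraph_iso_def)
  interpret wf_digraph "with_proj F" using h(1) by (simp add: pre_digraph.digraph_isomorphism_def)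
  have "arcs_ends (with_proj H) = map_prod (iso_verts h) (iso_verts h) ` arcs_ends (with_proj F)"
    using arcs_ends_app_iso_eq[OF h(1)] h(2) by (simp add: map_prod_def)
  moreover have "verts (with_proj H) = iso_verts h ` pverts F" using h(2) by simp
  ultimately show ?thesis
    using that[of "iso_verts h"] h(1) by (simp add: pre_digraph.digraph_isomorphism_def)
qed

lemma digraph_iso_card:
  assumes "pair_graph F" "digraph_iso (with_proj F) (with_proj H)"
  shows "card (pverts H) = card (pverts F)" "card (parcs H) = card (parcs F)"
proof -
  obtain f where f: "inj_on f (pverts F)" "pverts H = f ` pverts F" "parcs H = map_prod f f ` parcs F"
    using assms(2) by (rule digraph_isoE)
  show "card (pverts H) = card (pverts F)" using f by (simp add: card_image)
  have "parcs F \<subseteq> pverts F \<times> pverts F" using assms(1) by (simp add: pair_graph_iff)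
  then have "inj_on (map_prod f f) (parcs F)"
    using map_prod_inj_on[OF f(1) f(1)] inj_on_subset by blast
  then show "card (parcs H) = card (parcs F)" using f by (simp add: card_image)
qed

lemma digraph_iso_triangle_free:
  assumes "digraph_iso (with_proj F) (with_proj H)" "triangle_free H"
  shows "triangle_free F"
proof -
  obtain f where "parcs H = map_prod f f ` parcs F" using assms(1) by (rule digraph_isoE)
  then have "(u, v) \<in> parcs F \<Longrightarrow> (f u, f v) \<in> parcs H" for u v by force
  then show ?thesis using assms(2) unfolding triangle_free_def by blast
qed

section \<open>Graphs without triangles and without three independent vertices\<close>

definition graph_on :: "nat \<Rightarrow> (nat \<times> nat) set \<Rightarrow> nat pair_pre_digraph" where
  "graph_on n A = \<lparr>pverts = {..<n}, parcs = {(i, j). i < n \<and> j < n \<and> ((i, j) \<in> A \<or> (j, i) \<in> A)}\<rparr>"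

text \<open>An isomorphism from \<open>graph_on n A\<close> to \<open>F\<close>, stored as the list
  of images of \<open>0\<close>, ..., \<open>n - 1\<close>, so that concrete cases reduce to
  finitely many index checks.\<close>

definition listing :: "'a pair_pre_digraph \<Rightarrow> nat \<Rightarrow> (nat \<times> nat) set \<Rightarrow> 'a list \<Rightarrow> bool" where
  "listing F n A xs \<longleftrightarrow> length xs = n \<and> distinct xs \<and> set xs = pverts F \<and>
     (\<forall>i<n. \<forall>j<n. (xs ! i, xs ! j) \<in> parcs F \<longleftrightarrow> (i, j) \<in> A \<or> (j, i) \<in> A)"

lemma pair_graph_graph_on: "irrefl A \<Longrightarrow> pair_graph (graph_on n A)"
  by (auto simp: pair_graph_iff graph_on_def irrefl_def)

lemma listing_digraph_iso:
  assumes F: "pair_graph F" and A: "irrefl A" and xs: "listing F n A xs"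
  shows "digraph_iso (with_proj F) (with_proj (graph_on n A))"
    and "digraph_iso (with_proj (graph_on n A)) (with_proj F)"
proof -
  show iso: "digraph_iso (with_proj (graph_on n A)) (with_proj F)"
  proof (rule digraph_isoI[OF pair_graph_graph_on[OF A] F, where f = "(!) xs"])
    show "inj_on ((!) xs) (pverts (graph_on n A))"
      using xs by (auto simp: listing_def graph_on_def inj_on_def nth_eq_iff_index_eq)
    show "(!) xs ` pverts (graph_on n A) = pverts F"
      using xs by (auto simp: listing_def graph_on_def set_conv_nth)
  qed (use xs in \<open>auto simp: listing_def graph_on_def\<close>)
  show "digraph_iso (with_proj F) (with_proj (graph_on n A))"
    using pair_graph_graph_on[OF A] by (intro digraph_iso_swap[OF _ iso])
      (simp add: wf_digraph_wp_iff pair_graph_def pair_digraph_def pair_fin_digraph_def)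
qed

text \<open>In order: a point, an edge, two points, the path on three vertices, an edge and a point,
  the path on four vertices, two disjoint edges. Each edge is listed in one direction.\<close>

definition small_forests :: "(nat \<times> (nat \<times> nat) set) set" where
  "small_forests = {(1, {}), (2, {(0, 1)}), (2, {}), (3, {(0, 1), (1, 2)}), (3, {(0, 1)}),
     (4, {(0, 1), (1, 2), (2, 3)}), (4, {(0, 1), (2, 3)})}"

definition small_cycles :: "(nat \<times> (nat \<times> nat) set) set" where
  "small_cycles = {(4, {(0, 1), (1, 2), (2, 3), (3, 0)}), (5, {(0, 1), (1, 2), (2, 3), (3, 4), (4, 0)})}"

definition no_independent_triple :: "'a pair_pre_digraph \<Rightarrow> bool" where
  "no_independent_triple F \<longleftrightarrow> (\<forall>a \<in> pverts F. \<forall>b \<in> pverts F. \<forall>c \<in> pverts F.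
     a \<noteq> b \<longrightarrow> a \<noteq> c \<longrightarrow> b \<noteq> c \<longrightarrow> (a, b) \<in> parcs F \<or> (a, c) \<in> parcs F \<or> (b, c) \<in> parcs F)"

lemma no_independent_triple_iff:
  assumes "pair_graph F"
  shows "no_independent_triple F \<longleftrightarrow> \<not> (\<exists>S. independent_set (with_proj F) S \<and> card S = 3)"
proof
  assume F: "no_independent_triple F"
  show "\<not> (\<exists>S. independent_set (with_proj F) S \<and> card S = 3)"
  proof
    assume "\<exists>S. independent_set (with_proj F) S \<and> card S = 3"
    then obtain a b c where "independent_set (with_proj F) {a, b, c}" "a \<noteq> b" "b \<noteq> c" "a \<noteq> c"
      by (auto simp: card_3_iff)
    then show False using F by (auto simp: independent_set_def no_independent_triple_def)
  qed
next
  assume R: "\<not> (\<exists>S. independent_set (with_proj F) S \<and> card S = 3)"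
  show "no_independent_triple F"
    unfolding no_independent_triple_def
  proof (intro ballI impI, rule ccontr)
    fix a b c assume abc: "a \<in> pverts F" "b \<in> pverts F" "c \<in> pverts F" "a \<noteq> b" "a \<noteq> c" "b \<noteq> c"
      "\<not> ((a, b) \<in> parcs F \<or> (a, c) \<in> parcs F \<or> (b, c) \<in> parcs F)"
    then have "independent_set (with_proj F) {a, b, c}"
      using assms by (auto simp: independent_set_def pair_graph_iff)
    moreover have "card {a, b, c} = 3" using abc by simp
    ultimately show False using R by blast
  qed
qed

lemma card_le_2_cases:
  assumes "finite A" "\<not> (\<exists>a b c. a \<in> A \<and> b \<in> A \<and> c \<in> A \<and> a \<noteq> b \<and> a \<noteq> c \<and> b \<noteq> c)"
  obtains "A = {}" | a where "A = {a}" | a b where "A = {a, b}" "a \<noteq> b"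
proof -
  consider "A = {}" | a where "A = {a}" | a b where "a \<in> A" "b \<in> A" "a \<noteq> b" by blast
  then show thesis
  proof cases
    case (3 a b)
    then have "A = {a, b}" using assms(2) by blast
    then show thesis using 3 that by blast
  qed (use that in blast)+
qed

text \<open>Fix a vertex \<open>a\<close>. Its neighbours \<open>N\<close> are pairwise
  non-adjacent, as there is no triangle, and its non-neighbours \<open>M\<close> are pairwise
  adjacent, as there is no independent triple; so both sets have at most two elements. What remains
  is to split into cases by the edges between \<open>N\<close> and \<open>M\<close>.\<close>

theorem small_graph_classification:
  assumes F: "pair_graph F" "pverts F \<noteq> {}" "triangle_free F" "no_independent_triple F"
  shows "\<exists>n A xs. (n, A) \<in> small_forests \<union> small_cycles \<and> listing F n A xs"
proof -
  define E where "E u v \<longleftrightarrow> (u, v) \<in> parcs F" for u v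
  have sym: "E u v \<Longrightarrow> E v u" and nsym: "\<not> E u v \<Longrightarrow> \<not> E v u" and irr: "\<not> E u u" for u v
    using F(1) by (auto simp: pair_graph_iff E_def)
  have tri: False if "E x y" "E y z" "E x z" for x y z
    using F(3) that(1,2) sym[OF that(3)] unfolding triangle_free_def E_def by blast
  have ind: "E x y \<or> E x z \<or> E y z" if "x \<in> pverts F" "y \<in> pverts F" "z \<in> pverts F" "x \<noteq> y" "x \<noteq> z" "y \<noteq> z" for x y z
    using F(4) that unfolding no_independent_triple_def E_def by blast
  have fin: "finite (pverts F)" using F(1) by (simp add: pair_graph_iff)
  obtain a where a: "a \<in> pverts F" using F(2) by blast
  define N where "N = {v \<in> pverts F. E a v}"
  define M where "M = {v \<in> pverts F. v \<noteq> a \<and> \<not> E a v}"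
  have V: "pverts F = insert a (N \<union> M)" using a by (auto simp: N_def M_def)
  have "finite N" "finite M" using fin by (auto simp: N_def M_def)
  have NE: "E a x" "x \<noteq> a" "a \<noteq> x" "x \<in> pverts F" if "x \<in> N" for x using that irr by (auto simp: N_def)
  have ME: "\<not> E a x" "x \<noteq> a" "a \<noteq> x" "x \<in> pverts F" if "x \<in> M" for x using that by (auto simp: M_def)
  have NN: "\<not> E x y" if "x \<in> N" "y \<in> N" for x y using NE(1) that tri by blast
  have MM: "E x y" if "x \<in> M" "y \<in> M" "x \<noteq> y" for x y using ind[OF a, of x y] ME that by blast
  have NM: "x \<noteq> y" "y \<noteq> x" if "x \<in> N" "y \<in> M" for x y using that by (auto simp: N_def M_def)
  have N2: "\<not> (\<exists>x y z. x \<in> N \<and> y \<in> N \<and> z \<in> N \<and> x \<noteq> y \<and> x \<noteq> z \<and> y \<noteq> z)"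
    using ind NN NE(4) by blast
  have M2: "\<not> (\<exists>x y z. x \<in> M \<and> y \<in> M \<and> z \<in> M \<and> x \<noteq> y \<and> x \<noteq> z \<and> y \<noteq> z)"
    using tri MM by blast
  have goal: ?thesis if "(n, A) \<in> small_forests \<union> small_cycles" "length xs = n" "distinct xs" "set xs = pverts F"
    "\<forall>i<n. \<forall>j<n. E (xs ! i) (xs ! j) \<longleftrightarrow> (i, j) \<in> A \<or> (j, i) \<in> A" for n A xs
    using that by (intro exI[of _ n] exI[of _ A] exI[of _ xs]) (simp add: listing_def E_def)
  note data = small_forests_def small_cycles_def All_less_Suc numeral_eq_Suc irr
  show ?thesis
  proof (cases rule: card_le_2_cases[OF \<open>finite N\<close> N2])
    case N: 1
    show ?thesis
    proof (cases rule: card_le_2_cases[OF \<open>finite M\<close> M2])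
      case M: 1
      show ?thesis by (rule goal[of 1 "{}" "[a]"]) (use V N M in \<open>auto simp: data\<close>)
    next
      case M: (2 b)
      note l = ME[of b]
      show ?thesis by (rule goal[of 2 "{}" "[a, b]"]) (use V N M l l(1)[THEN nsym] in \<open>auto simp: data\<close>)
    next
      case M: (3 b c)
      note l = ME[of b] ME[of c] and e = MM[of b c]
      show ?thesis by (rule goal[of 3 "{(0,1)}" "[b, c, a]"])
        (use V N M l l(1,5)[THEN nsym] e e[THEN sym] in \<open>auto simp: data\<close>)
    qed
  next
    case N: (2 b)
    show ?thesis
    proof (cases rule: card_le_2_cases[OF \<open>finite M\<close> M2])
      case M: 1
      note l = NE[of b]
      show ?thesis by (rule goal[of 2 "{(0,1)}" "[a, b]"]) (use V N M l l(1)[THEN sym] in \<open>auto simp: data\<close>)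
    next
      case M: (2 c)
      note l = NE[of b] ME[of c] NM[of b c] NE(1)[of b, THEN sym] ME(1)[of c, THEN nsym]
      show ?thesis
      proof (cases "E b c")
        case True
        show ?thesis by (rule goal[of 3 "{(0,1),(1,2)}" "[a, b, c]"])
            (use V N M l True True[THEN sym] in \<open>auto simp: data\<close>)
      next
        case False
        show ?thesis by (rule goal[of 3 "{(0,1)}" "[a, b, c]"])
            (use V N M l False False[THEN nsym] in \<open>auto simp: data\<close>)
      qed
    next
      case M: (3 c d)
      note l = NE[of b] ME[of c] ME[of d] NM[of b c] NM[of b d] MM[of c d] 
      note l' = l l(1)[THEN sym] l(5)[THEN nsym] l(9)[THEN nsym] MM[of d c]
      \<comment> \<open>\<open>c\<close> and \<open>d\<close> are adjacent, so joining
        \<open>b\<close> to both would close a triangle.\<close>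
      have "\<not> (E b c \<and> E b d)" using tri[of b c d] l M by auto
      then consider "E b c" "\<not> E b d" | "E b d" "\<not> E b c" | "\<not> E b c" "\<not> E b d" by blast
      then show ?thesis
      proof cases
        case 1
        show ?thesis by (rule goal[of 4 "{(0,1),(1,2),(2,3)}" "[a, b, c, d]"])
            (use V N M l' 1 1(1)[THEN sym] 1(2)[THEN nsym] in \<open>auto simp: data\<close>)
      next
        case 2
        show ?thesis by (rule goal[of 4 "{(0,1),(1,2),(2,3)}" "[a, b, d, c]"])
            (use V N M l' 2 2(1)[THEN sym] 2(2)[THEN nsym] in \<open>auto simp: data\<close>)
      next
        case 3
        show ?thesis by (rule goal[of 4 "{(0,1),(2,3)}" "[a, b, c, d]"])
            (use V N M l' 3 3(1)[THEN nsym] 3(2)[THEN nsym] in \<open>auto simp: data\<close>)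
      qed
    qed
  next
    case N: (3 b e)
    note l = NE[of b] NE[of e] NN[of b e] NN[of e b] NE(1)[of b, THEN sym] NE(1)[of e, THEN sym]
    show ?thesis
    proof (cases rule: card_le_2_cases[OF \<open>finite M\<close> M2])
      case M: 1
      show ?thesis by (rule goal[of 3 "{(0,1),(1,2)}" "[b, a, e]"]) (use V N M l in \<open>auto simp: data\<close>)
    next
      case M: (2 c)
      note m = l ME[of c] NM[of b c] NM[of e c] ME(1)[of c, THEN nsym]
      \<comment> \<open>\<open>b\<close> and \<open>e\<close>, both neighbours of \<open>a\<close>,
        are not adjacent, so \<open>c\<close> is joined to at least one of them.\<close>
      have "E b c \<or> E e c" using ind[of b e c] m N M by auto
      then consider "E b c" "\<not> E e c" | "E e c" "\<not> E b c" | "E b c" "E e c" by blast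
      then show ?thesis
      proof cases
        case 1
        show ?thesis by (rule goal[of 4 "{(0,1),(1,2),(2,3)}" "[e, a, b, c]"])
            (use V N M m 1 1(1)[THEN sym] 1(2)[THEN nsym] in \<open>auto simp: data\<close>)
      next
        case 2
        show ?thesis by (rule goal[of 4 "{(0,1),(1,2),(2,3)}" "[b, a, e, c]"])
            (use V N M m 2 2(1)[THEN sym] 2(2)[THEN nsym] in \<open>auto simp: data\<close>)
      next
        case 3
        show ?thesis by (rule goal[of 4 "{(0,1),(1,2),(2,3),(3,0)}" "[a, b, c, e]"])
            (use V N M m 3 3(1)[THEN sym] 3(2)[THEN sym] in \<open>auto simp: data\<close>)
      qed
    next
      case M: (3 c d)
      note m = l ME[of c] ME[of d] NM[of b c] NM[of e c] NM[of b d] NM[of e d] MM[of c d] MM[of d c]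
        ME(1)[of c, THEN nsym] ME(1)[of d, THEN nsym]
      \<comment> \<open>Each of \<open>c\<close>, \<open>d\<close> is joined to one of
        \<open>b\<close>, \<open>e\<close>, and neither \<open>b\<close> nor \<open>e\<close> to
        both \<open>c\<close> and \<open>d\<close>. So the edges between the two pairs form a
        perfect matching, which closes a 5-cycle through \<open>a\<close>.\<close>
      have "E b c \<or> E e c" "E b d \<or> E e d" using ind[of b e c] ind[of b e d] m N M by auto
      moreover have "\<not> (E b c \<and> E b d)" "\<not> (E e c \<and> E e d)"
        using tri[of b c d] tri[of e c d] m M by auto
      ultimately consider "E b c" "E e d" "\<not> E b d" "\<not> E e c" | "E b d" "E e c" "\<not> E b c" "\<not> E e d"
        by blast
      then show ?thesis
      proof cases
        case 1
        show ?thesis by (rule goal[of 5 "{(0,1),(1,2),(2,3),(3,4),(4,0)}" "[a, b, c, d, e]"])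
            (use V N M m 1 1(1,2)[THEN sym] 1(3,4)[THEN nsym] in \<open>auto simp: data\<close>)
      next
        case 2
        show ?thesis by (rule goal[of 5 "{(0,1),(1,2),(2,3),(3,4),(4,0)}" "[a, b, d, c, e]"])
            (use V N M m 2 2(1,2)[THEN sym] 2(3,4)[THEN nsym] in \<open>auto simp: data\<close>)
      qed
    qed
  qed
qed

lemma small_graphs_irrefl: "(n, A) \<in> small_forests \<union> small_cycles \<Longrightarrow> irrefl A"
  by (auto simp: small_forests_def small_cycles_def irrefl_def)

lemma parcs_graph_on:
  assumes "A \<subseteq> {..<n} \<times> {..<n}"
  shows "parcs (graph_on n A) = A \<union> prod.swap ` A"
  using assms by (force simp: graph_on_def)

text \<open>The second entry is twice the number of edges. On the seven forests this pair is a
  complete isomorphism invariant.\<close>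

definition size_pair :: "'a pair_pre_digraph \<Rightarrow> nat \<times> nat" where
  "size_pair F = (card (pverts F), card (parcs F))"

lemma size_pair_small_forests:
  "(\<lambda>(n, A). size_pair (graph_on n A)) ` small_forests = {(1, 0), (2, 2), (2, 0), (3, 4), (3, 2), (4, 6), (4, 4)}"
  by (simp add: small_forests_def size_pair_def parcs_graph_on) (simp add: graph_on_def numeral_eq_Suc)

text \<open>The image has seven elements and the set at most seven.\<close>

lemma inj_size_pair_small_forests: "inj_on (\<lambda>(n, A). size_pair (graph_on n A)) small_forests"
proof (rule eq_card_imp_inj_on)
  have "card small_forests \<le> 7" by (auto simp: small_forests_def card_insert_if)
  moreover have "finite small_forests" by (simp add: small_forests_def)
  ultimately show "card ((\<lambda>(n, A). size_pair (graph_on n A)) ` small_forests) = card small_forests"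
    using card_image_le[of small_forests "\<lambda>(n, A). size_pair (graph_on n A)"]
    by (simp add: size_pair_small_forests)
qed (simp add: small_forests_def)

lemma exceptional_forest_iff:
  "exceptional_forest F \<longleftrightarrow>
    pair_graph F \<and> uforest (with_proj F) \<and> pverts F \<noteq> {} \<and> no_independent_triple F"
  by (auto simp: exceptional_forest_def no_independent_triple_iff)

text \<open>The hypothesis runs over decreasing triples, so for a concrete \<open>n\<close> it
  unfolds to a short finite check; the other orders of a triple follow from the symmetry of the
  arcs.\<close>

lemma no_independent_triple_graph_on:
  assumes R: "\<forall>a<n. \<forall>b<a. \<forall>c<b.
    (a, b) \<in> A \<or> (b, a) \<in> A \<or> (a, c) \<in> A \<or> (c, a) \<in> A \<or> (b, c) \<in> A \<or> (c, b) \<in> A"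
  shows "no_independent_triple (graph_on n A)"
  unfolding no_independent_triple_def
proof (intro ballI impI)
    fix a b c assume "a \<in> pverts (graph_on n A)" "b \<in> pverts (graph_on n A)" "c \<in> pverts (graph_on n A)"
      and ne: "a \<noteq> b" "a \<noteq> c" "b \<noteq> c"
    then have lt: "a < n" "b < n" "c < n" by (auto simp: graph_on_def)
    consider "b < a" "c < b" | "c < a" "b < c" | "a < b" "c < a" | "c < b" "a < c" | "a < c" "b < a" | "b < c" "a < b"
      using ne by (metis linorder_neqE_nat)
    then show "(a, b) \<in> parcs (graph_on n A) \<or> (a, c) \<in> parcs (graph_on n A) \<or> (b, c) \<in> parcs (graph_on n A)"
      using R lt by cases (auto simp: graph_on_def)
qed

lemma triangle_free_graph_on:
  assumes "irrefl A"
    and R: "\<forall>a<n. \<forall>b<a. \<forall>c<b.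
      \<not> (((a, b) \<in> A \<or> (b, a) \<in> A) \<and> ((a, c) \<in> A \<or> (c, a) \<in> A) \<and> ((b, c) \<in> A \<or> (c, b) \<in> A))"
  shows "triangle_free (graph_on n A)"
  unfolding triangle_free_def
proof safe
  fix a b c assume abc: "(a, b) \<in> parcs (graph_on n A)" "(b, c) \<in> parcs (graph_on n A)" "(c, a) \<in> parcs (graph_on n A)"
  then have lt: "a < n" "b < n" "c < n" and "a \<noteq> b" "a \<noteq> c" "b \<noteq> c"
    using assms(1) by (auto simp: graph_on_def irrefl_def)
  then consider "b < a" "c < b" | "c < a" "b < c" | "a < b" "c < a" | "c < b" "a < c" | "a < c" "b < a" | "b < c" "a < b"
    by (metis linorder_neqE_nat)
  then show False
    by cases (use R lt abc in \<open>auto simp: graph_on_def\<close>)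
qed

lemma small_graphs_triangle_free:
  assumes "(n, A) \<in> small_forests \<union> small_cycles"
  shows "triangle_free (graph_on n A)"
proof (rule triangle_free_graph_on[OF small_graphs_irrefl[OF assms]])
  show "\<forall>a<n. \<forall>b<a. \<forall>c<b.
      \<not> (((a, b) \<in> A \<or> (b, a) \<in> A) \<and> ((a, c) \<in> A \<or> (c, a) \<in> A) \<and> ((b, c) \<in> A \<or> (c, b) \<in> A))"
    using assms by (auto simp: small_forests_def small_cycles_def numeral_eq_Suc All_less_Suc)
qed

lemma small_forests_exceptional:
  assumes "(n, A) \<in> small_forests"
  shows "exceptional_forest (graph_on n A)"
proof -
  have "pair_graph (graph_on n A)"
    using assms by (intro pair_graph_graph_on small_graphs_irrefl) auto
  moreover have "size_pair (graph_on n A) \<in> {(1, 0), (2, 2), (2, 0), (3, 4), (3, 2), (4, 6), (4, 4)}"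
    using assms size_pair_small_forests by force
  then have "card (parcs (graph_on n A)) < 8" by (auto simp: size_pair_def)
  moreover have "triangle_free (graph_on n A)"
    using assms by (intro small_graphs_triangle_free) simp
  moreover have "pverts (graph_on n A) \<noteq> {}"
  proof -
    have "0 < n" using assms by (auto simp: small_forests_def)
    then have "0 \<in> pverts (graph_on n A)" by (simp add: graph_on_def)
    then show ?thesis by blast
  qed
  moreover have "no_independent_triple (graph_on n A)"
  proof (rule no_independent_triple_graph_on)
    show "\<forall>a<n. \<forall>b<a. \<forall>c<b.
      (a, b) \<in> A \<or> (b, a) \<in> A \<or> (a, c) \<in> A \<or> (c, a) \<in> A \<or> (b, c) \<in> A \<or> (c, b) \<in> A"
      using assms unfolding small_forests_def
      by (elim insertE emptyE; simp) (simp_all add: All_less_Suc numeral_eq_Suc)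
  qed
  ultimately show ?thesis by (simp add: exceptional_forest_iff uforest_if_few_arcs)
qed

lemma cycle_graph_4: "cycle_graph 4 = graph_on 4 {(0, 1), (1, 2), (2, 3), (3, 0)}"
proof -
  have "i < 4 \<and> j < 4 \<and> (j = Suc i mod 4 \<or> i = Suc j mod 4) \<longleftrightarrow>
      i < 4 \<and> j < 4 \<and> ((i, j) \<in> {(0, 1), (1, 2), (2, 3), (3, 0)} \<or> (j, i) \<in> {(0, 1), (1, 2), (2, 3), (3, 0)})" for i j :: nat
  proof (cases "i < 4 \<and> j < 4")
    case True
    then have "i \<in> {0, 1, 2, 3}" "j \<in> {0, 1, 2, 3}" by auto
    then show ?thesis by (elim insertE emptyE) simp_all
  qed blast
  then show ?thesis unfolding cycle_graph_def graph_on_def by (simp only:)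
qed

lemma cycle_graph_5: "cycle_graph 5 = graph_on 5 {(0, 1), (1, 2), (2, 3), (3, 4), (4, 0)}"
proof -
  have "i < 5 \<and> j < 5 \<and> (j = Suc i mod 5 \<or> i = Suc j mod 5) \<longleftrightarrow>
      i < 5 \<and> j < 5 \<and> ((i, j) \<in> {(0, 1), (1, 2), (2, 3), (3, 4), (4, 0)} \<or> (j, i) \<in> {(0, 1), (1, 2), (2, 3), (3, 4), (4, 0)})" for i j :: nat
  proof (cases "i < 5 \<and> j < 5")
    case True
    then have "i \<in> {0, 1, 2, 3, 4}" "j \<in> {0, 1, 2, 3, 4}" by auto
    then show ?thesis by (elim insertE emptyE) simp_all
  qed blast
  then show ?thesis unfolding cycle_graph_def graph_on_def by (simp only:)
qed

lemma small_cycles_not_uforest: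
  assumes F: "pair_graph F" and "(n, A) \<in> small_cycles" "listing F n A xs"
  shows "\<not> uforest (with_proj F)"
proof -
  have arc: "(xs ! i, xs ! j) \<in> parcs F" if "(i, j) \<in> A" "i < n" "j < n" for i j
    using that assms(3) by (simp add: listing_def)
  have ne: "xs ! i \<noteq> xs ! j" if "i < n" "j < n" "i \<noteq> j" for i j
    using that assms(3) by (simp add: listing_def nth_eq_iff_index_eq)
  let ?x = "(!) xs"
  consider "n = 4" "A = {(0, 1), (1, 2), (2, 3), (3, 0)}"
    | "n = 5" "A = {(0, 1), (1, 2), (2, 3), (3, 4), (4, 0)}"
    using assms(2) by (auto simp: small_cycles_def)
  then have "\<exists>p. ucycle (with_proj F) p"
  proof cases
    case 1
    have "ucycle (with_proj F) [(?x 0, ?x 1), (?x 1, ?x 2), (?x 2, ?x 3), (?x 3, ?x 0)]"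
      using 1 by (intro ucycleI[OF F, where u = "?x 0"]) (simp_all add: arc ne)
    then show ?thesis ..
  next
    case 2
    have "ucycle (with_proj F) [(?x 0, ?x 1), (?x 1, ?x 2), (?x 2, ?x 3), (?x 3, ?x 4), (?x 4, ?x 0)]"
      using 2 by (intro ucycleI[OF F, where u = "?x 0"]) (simp_all add: arc ne)
    then show ?thesis ..
  qed
  then show ?thesis by (simp add: uforest_def)
qed

lemma uforest_triangle_free:
  assumes "pair_graph F" "uforest (with_proj F)"
  shows "triangle_free F"
  unfolding triangle_free_def
proof clarify
  fix a b c assume "(a, b) \<in> parcs F" "(b, c) \<in> parcs F" "(c, a) \<in> parcs F"
  then have "ucycle (with_proj F) [(a, b), (b, c), (c, a)]"
    using assms(1) by (rule triangle_ucycle[rotated])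
  then show False using assms(2) unfolding uforest_def by blast
qed

lemma exceptional_forest_iso_small_forest:
  assumes "exceptional_forest F"
  shows "\<exists>(n, A) \<in> small_forests. digraph_iso (with_proj F) (with_proj (graph_on n A))
    \<and> digraph_iso (with_proj (graph_on n A)) (with_proj F)"
proof -
  have F: "pair_graph F" "uforest (with_proj F)" "pverts F \<noteq> {}" "no_independent_triple F"
    using assms by (auto simp: exceptional_forest_iff)
  then obtain n A xs where nA: "(n, A) \<in> small_forests \<union> small_cycles" "listing F n A xs"
    using small_graph_classification[OF F(1,3) uforest_triangle_free[OF F(1,2)] F(4)] by (elim exE conjE)
  then have "(n, A) \<in> small_forests"
    using small_cycles_not_uforest[OF F(1)] F(2) by blast
  then show ?thesis
    using listing_digraph_iso[OF F(1) small_graphs_irrefl[OF nA(1)] nA(2)] by blast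
qed

text \<open>From left to right this is the classification, the forests being recognized by their
  number of arcs. Conversely, neither the two cycles nor the forests contain a triangle, and an
  isomorphism would transport one.\<close>

lemma triangle_free_small_graph_cases:
  assumes F: "pair_graph F" "pverts F \<noteq> {}" "no_independent_triple F"
  shows "triangle_free F \<longleftrightarrow> digraph_iso (with_proj F) (with_proj (cycle_graph 4)) \<or>
    digraph_iso (with_proj F) (with_proj (cycle_graph 5)) \<or> exceptional_forest F"
proof
  assume tf: "triangle_free F"
  obtain n A xs where nA: "(n, A) \<in> small_forests \<union> small_cycles" "listing F n A xs"
    using small_graph_classification[OF F(1,2) tf F(3)] by (elim exE conjE)
  have iso: "digraph_iso (with_proj F) (with_proj (graph_on n A))"
    using listing_digraph_iso[OF F(1) small_graphs_irrefl[OF nA(1)] nA(2)] by blast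
  show "digraph_iso (with_proj F) (with_proj (cycle_graph 4)) \<or>
    digraph_iso (with_proj F) (with_proj (cycle_graph 5)) \<or> exceptional_forest F"
  proof (cases "(n, A) \<in> small_forests")
    case True
    then have "size_pair (graph_on n A) \<in> {(1, 0), (2, 2), (2, 0), (3, 4), (3, 2), (4, 6), (4, 4)}"
      using size_pair_small_forests by force
    then have "card (parcs F) < 8"
      using digraph_iso_card(2)[OF F(1) iso] by (auto simp: size_pair_def)
    then show ?thesis using F tf by (simp add: exceptional_forest_iff uforest_if_few_arcs)
  next
    case False
    then show ?thesis
      using nA(1) iso by (auto simp: small_cycles_def cycle_graph_4 cycle_graph_5)
  qed
next
  assume R: "digraph_iso (with_proj F) (with_proj (cycle_graph 4)) \<or>
    digraph_iso (with_proj F) (with_proj (cycle_graph 5)) \<or> exceptional_forest F"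
  have "triangle_free (cycle_graph 4)" "triangle_free (cycle_graph 5)"
    unfolding cycle_graph_4 cycle_graph_5
    by (rule small_graphs_triangle_free; simp add: small_cycles_def)+
  then show "triangle_free F"
    using R digraph_iso_triangle_free uforest_triangle_free by (auto simp: exceptional_forest_iff)
qed

section \<open>Counting isomorphism classes\<close>

lemma card_quotient_eq_card_image:
  assumes "\<And>x y. (x, y) \<in> r \<longleftrightarrow> x \<in> A \<and> y \<in> A \<and> f x = f y"
  shows "card (A // r) = card (f ` A)"
proof -
  have "r `` {x} = {y \<in> A. f y = f x}" if "x \<in> A" for x
    using assms that by auto
  moreover have "A // r = (\<lambda>x. r `` {x}) ` A" by (auto simp: quotient_def)
  \<comment> \<open>The classes are the nonempty fibres of \<open>f\<close>, indexed by its
    values.\<close>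
  ultimately have "A // r = (\<lambda>k. {y \<in> A. f y = k}) ` f ` A"
    unfolding image_image by (metis (no_types, lifting) image_cong)
  moreover have "inj_on (\<lambda>k. {y \<in> A. f y = k}) (f ` A)"
    by (auto simp: inj_on_def)
  ultimately show ?thesis by (simp add: card_image)
qed

lemma size_pair_digraph_iso:
  "pair_graph F \<Longrightarrow> digraph_iso (with_proj F) (with_proj H) \<Longrightarrow> size_pair H = size_pair F"
  by (simp add: size_pair_def digraph_iso_card)

text \<open>Each exceptional forest is isomorphic to a member of \<open>small_forests\<close>, where
  \<open>size_pair\<close> is injective; so \<open>size_pair\<close> separates the classes, and it
  takes seven values.\<close>

theorem card_exceptional_forests_iso_classes:
  "card ({F :: nat pair_pre_digraph. exceptional_forest F} //
     {(F, F'). exceptional_forest F \<and> exceptional_forest F' \<and> digraph_iso (with_proj F) (with_proj F')}) = 7"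
proof -
  let ?X = "{F :: nat pair_pre_digraph. exceptional_forest F}"
  have iso: "digraph_iso (with_proj F) (with_proj F') \<longleftrightarrow> size_pair F = size_pair F'"
    if F: "exceptional_forest F" "exceptional_forest F'" for F F' :: "nat pair_pre_digraph"
  proof
    assume "digraph_iso (with_proj F) (with_proj F')"
    then show "size_pair F = size_pair F'"
      using F(1) size_pair_digraph_iso[of F F'] by (simp add: exceptional_forest_iff)
  next
    assume eq: "size_pair F = size_pair F'"
    obtain n A where nA: "(n, A) \<in> small_forests" "digraph_iso (with_proj F) (with_proj (graph_on n A))"
      using exceptional_forest_iso_small_forest[OF F(1)] by blast
    obtain m B where mB: "(m, B) \<in> small_forests" "digraph_iso (with_proj F') (with_proj (graph_on m B))"
      "digraph_iso (with_proj (graph_on m B)) (with_proj F')"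
      using exceptional_forest_iso_small_forest[OF F(2)] by blast
    have "size_pair (graph_on n A) = size_pair (graph_on m B)"
      using eq F size_pair_digraph_iso[OF _ nA(2)] size_pair_digraph_iso[OF _ mB(2)]
      by (simp add: exceptional_forest_iff)
    then have "(n, A) = (m, B)" using inj_onD[OF inj_size_pair_small_forests _ nA(1) mB(1)] by simp
    then show "digraph_iso (with_proj F) (with_proj F')" using nA(2) mB(3) digraph_iso_trans by blast
  qed
  have "size_pair ` ?X = (\<lambda>(n, A). size_pair (graph_on n A)) ` small_forests"
  proof
    show "size_pair ` ?X \<subseteq> (\<lambda>(n, A). size_pair (graph_on n A)) ` small_forests"
    proof (rule image_subsetI)
      fix F :: "nat pair_pre_digraph" assume "F \<in> ?X"
      then have F: "exceptional_forest F" by simp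
      then obtain n A where "(n, A) \<in> small_forests" "digraph_iso (with_proj F) (with_proj (graph_on n A))"
        using exceptional_forest_iso_small_forest by blast
      moreover from this have "size_pair (graph_on n A) = size_pair F"
        using F size_pair_digraph_iso[of F "graph_on n A"] by (simp add: exceptional_forest_iff)
      ultimately show "size_pair F \<in> (\<lambda>(n, A). size_pair (graph_on n A)) ` small_forests" by force
    qed
    show "(\<lambda>(n, A). size_pair (graph_on n A)) ` small_forests \<subseteq> size_pair ` ?X"
      using small_forests_exceptional by auto
  qed
  then have "card (size_pair ` ?X) = 7" by (simp add: size_pair_small_forests)
  then show ?thesis
    by (subst card_quotient_eq_card_image[where f = size_pair]) (use iso in auto)
qed

section \<open>Semidirect products\<close>

lemma (in group_hom) ord_hom_inj:
  assumes "inj_on h (carrier G)" "x \<in> carrier G"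
  shows "H.ord (h x) = G.ord x"
proof (rule dvd_antisym)
  have "h (x [^] H.ord (h x)) = h \<one>"
    using assms(2) by (simp add: hom_nat_pow)
  then have "x [^] H.ord (h x) = \<one>" using assms by (meson G.nat_pow_closed G.one_closed inj_onD)
  then show "G.ord x dvd H.ord (h x)" using assms(2) G.pow_eq_id by simp
qed (rule ord_hom_dvd[OF assms(2)])

lemma (in group_hom) prime_graph_iso:
  assumes "bij_betw h (carrier G) (carrier H)"
  shows "prime_graph G = prime_graph H"
proof -
  have "order G = order H" using assms by (simp add: order_def bij_betw_same_card)
  moreover have "(\<exists>x \<in> carrier G. G.ord x = n) \<longleftrightarrow> (\<exists>y \<in> carrier H. H.ord y = n)" for n
    using assms ord_hom_inj unfolding bij_betw_def by (metis hom_closed imageE)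
  ultimately show ?thesis by (simp add: prime_graph_def)
qed

text \<open>Transport of structure along an injection of the finite carrier into the natural
  numbers; this preserves solvability and the prime graph.\<close>

lemma occurs_as_solvable_prime_graphI:
  assumes G: "group G" "finite (carrier G)" "solvable G" and iso: "digraph_iso (with_proj (prime_graph G)) (with_proj F)"
  shows "occurs_as_solvable_prime_graph F"
proof -
  interpret G: group G by (rule G)
  obtain f :: "'a \<Rightarrow> nat" where f: "inj_on f (carrier G)"
    using finite_imp_inj_to_nat_seg[OF G(2)] by blast
  define g where "g = inv_into (carrier G) f"
  have gf [simp]: "g (f x) = x" if "x \<in> carrier G" for x using f that by (simp add: g_def)
  define H :: "nat monoid" where
    "H = \<lparr>carrier = f ` carrier G, monoid.mult = (\<lambda>x y. f (g x \<otimes>\<^bsub>G\<^esub> g y)), one = f \<one>\<^bsub>G\<^esub>\<rparr>"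
  have "group H"
  proof (rule groupI)
    fix x assume "x \<in> carrier H"
    then obtain a where a: "a \<in> carrier G" "x = f a" by (auto simp: H_def)
    then show "\<exists>y \<in> carrier H. y \<otimes>\<^bsub>H\<^esub> x = \<one>\<^bsub>H\<^esub>"
      by (intro bexI[of _ "f (inv\<^bsub>G\<^esub> a)"]) (auto simp: H_def)
  qed (auto simp: H_def G.m_assoc)
  have carrier_H: "carrier H = f ` carrier G" by (simp add: H_def)
  have "f \<in> hom G H" by (rule homI) (simp_all add: H_def)
  interpret f: group_hom G H f
    by (rule group_hom.intro[OF G.is_group \<open>group H\<close> group_hom_axioms.intro[OF \<open>f \<in> hom G H\<close>]])
  have bij: "bij_betw f (carrier G) (carrier H)" using f by (simp add: bij_betw_def carrier_H)
  have "solvable H" using f.surj_hom_imp_solvable[OF _ G(3)] by (simp add: carrier_H)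
  moreover have "finite (carrier H)" using G(2) by (simp add: carrier_H)
  ultimately show ?thesis
    using \<open>group H\<close> iso f.prime_graph_iso[OF bij] unfolding occurs_as_solvable_prime_graph_def by metis
qed

lemma (in comm_group) comm_group_solvable: "solvable G"
proof -
  have "(derived G ^^ 1) (carrier G) = {\<one>}" using derived_eq_singleton by simp
  then show ?thesis using solvable_iff_trivial_derived_seq by blast
qed

lemma (in comm_group) exists_ord_mult_comm:
  assumes "finite (carrier G)" "prime p" "prime q" "p \<noteq> q" "p dvd order G" "q dvd order G"
  shows "\<exists>x \<in> carrier G. ord x = p * q"
proof -
  obtain x y where xy: "x \<in> carrier G" "ord x = p" "y \<in> carrier G" "ord y = q"
    using cauchy[OF assms(1) subgroup_self] assms by (metis order_def)
  then have "ord (x \<otimes> y) = p * q"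
    using assms by (intro ord_mult_commuting_primes m_comm) auto
  then show ?thesis using xy by blast
qed

definition semidirect :: "('a, 'c) monoid_scheme \<Rightarrow> ('b, 'd) monoid_scheme \<Rightarrow> ('b \<Rightarrow> 'a \<Rightarrow> 'a) \<Rightarrow> ('a \<times> 'b) monoid" where
  "semidirect V H act = \<lparr>carrier = carrier V \<times> carrier H,
     monoid.mult = (\<lambda>(v, h) (w, k). (v \<otimes>\<^bsub>V\<^esub> act h w, h \<otimes>\<^bsub>H\<^esub> k)), one = (\<one>\<^bsub>V\<^esub>, \<one>\<^bsub>H\<^esub>)\<rparr>"

text \<open>The coprime orders place every prime divisor of the order of the semidirect product in
  exactly one of the two groups, so edges can be read off by cases.\<close>

locale coprime_action = V: comm_group V + H: group H
  for V :: "('a, 'c) monoid_scheme" and H :: "('b, 'd) monoid_scheme" +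
  fixes act :: "'b \<Rightarrow> 'a \<Rightarrow> 'a"
  assumes act_closed [simp]: "h \<in> carrier H \<Longrightarrow> v \<in> carrier V \<Longrightarrow> act h v \<in> carrier V"
    and act_mult: "h \<in> carrier H \<Longrightarrow> v \<in> carrier V \<Longrightarrow> w \<in> carrier V \<Longrightarrow>
      act h (v \<otimes>\<^bsub>V\<^esub> w) = act h v \<otimes>\<^bsub>V\<^esub> act h w"
    and act_one [simp]: "v \<in> carrier V \<Longrightarrow> act \<one>\<^bsub>H\<^esub> v = v"
    and act_act: "h \<in> carrier H \<Longrightarrow> k \<in> carrier H \<Longrightarrow> v \<in> carrier V \<Longrightarrow>
      act (h \<otimes>\<^bsub>H\<^esub> k) v = act h (act k v)"
    and finite_V: "finite (carrier V)" and finite_H: "finite (carrier H)"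
    and coprime_order: "coprime (order V) (order H)"
begin

abbreviation "G \<equiv> semidirect V H act"

lemma act_id [simp]:
  assumes "h \<in> carrier H"
  shows "act h \<one>\<^bsub>V\<^esub> = \<one>\<^bsub>V\<^esub>"
proof -
  have "act h \<one>\<^bsub>V\<^esub> \<otimes>\<^bsub>V\<^esub> act h \<one>\<^bsub>V\<^esub> = act h \<one>\<^bsub>V\<^esub>"
    using act_mult[OF assms V.one_closed V.one_closed] by simp
  then show ?thesis using assms V.l_cancel_one' by (metis V.one_closed act_closed)
qed

lemma group_semidirect: "group G"
proof (rule groupI)
  fix x assume "x \<in> carrier G"
  then obtain v h where x: "x = (v, h)" "v \<in> carrier V" "h \<in> carrier H" by (auto simp: semidirect_def)
  have "act (inv\<^bsub>H\<^esub> h) (inv\<^bsub>V\<^esub> v) \<otimes>\<^bsub>V\<^esub> act (inv\<^bsub>H\<^esub> h) v = \<one>\<^bsub>V\<^esub>"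
    using x by (simp flip: act_mult)
  then show "\<exists>y \<in> carrier G. y \<otimes>\<^bsub>G\<^esub> x = \<one>\<^bsub>G\<^esub>"
    using x by (intro bexI[of _ "(act (inv\<^bsub>H\<^esub> h) (inv\<^bsub>V\<^esub> v), inv\<^bsub>H\<^esub> h)"]) (auto simp: semidirect_def)
qed (auto simp: semidirect_def act_mult act_act V.m_assoc H.m_assoc)

lemma group_hom_snd: "group_hom G H snd"
  by (intro group_hom.intro group_hom_axioms.intro group_semidirect H.is_group homI)
    (auto simp: semidirect_def)

lemma group_hom_inl: "group_hom V G (\<lambda>v. (v, \<one>\<^bsub>H\<^esub>))"
  by (intro group_hom.intro group_hom_axioms.intro group_semidirect V.is_group homI)
    (auto simp: semidirect_def)

lemma group_hom_inr: "group_hom H G (\<lambda>h. (\<one>\<^bsub>V\<^esub>, h))"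
  by (intro group_hom.intro group_hom_axioms.intro group_semidirect H.is_group homI)
    (auto simp: semidirect_def)

interpretation G: group G by (rule group_semidirect)
lemma finite_semidirect: "finite (carrier G)"
  by (simp add: semidirect_def finite_V finite_H)

lemma order_semidirect: "order G = order V * order H"
  by (simp add: semidirect_def order_def card_cartesian_product)

lemma solvable_semidirect:
  assumes "solvable H"
  shows "solvable G"
proof (rule solvable_condition[OF group_hom_inl group_hom_snd _ _ V.comm_group_solvable assms])
  show "snd ` carrier G = carrier H" using V.one_closed by (force simp: semidirect_def)
  show "kernel G H snd \<subseteq> (\<lambda>v. (v, \<one>\<^bsub>H\<^esub>)) ` carrier V" by (auto simp: kernel_def semidirect_def)
qed

lemma ord_inl [simp]: "v \<in> carrier V \<Longrightarrow> G.ord (v, \<one>\<^bsub>H\<^esub>) = V.ord v"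
  by (rule group_hom.ord_hom_inj[OF group_hom_inl]) (auto simp: inj_on_def)

lemma ord_inr [simp]: "h \<in> carrier H \<Longrightarrow> G.ord (\<one>\<^bsub>V\<^esub>, h) = H.ord h"
  by (rule group_hom.ord_hom_inj[OF group_hom_inr]) (auto simp: inj_on_def)

text \<open>With \<open>d\<close> the order of the image in \<open>H\<close>, the power
  \<open>d\<close> of \<open>x\<close> lies in \<open>V\<close> and is killed by
  \<open>order V\<close>. So the order of \<open>x\<close> divides \<open>d * order V\<close>, and
  it is coprime to the second factor.\<close>

lemma ord_snd:
  assumes x: "x \<in> carrier G" and "coprime (G.ord x) (order V)"
  shows "H.ord (snd x) = G.ord x"
proof (rule dvd_antisym)
  let ?d = "H.ord (snd x)"
  have xd: "x [^]\<^bsub>G\<^esub> ?d \<in> carrier G" using x by simp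
  moreover have "snd (x [^]\<^bsub>G\<^esub> ?d) = \<one>\<^bsub>H\<^esub>"
    using x group_hom.hom_closed[OF group_hom_snd, OF x] by (simp add: group_hom.hom_nat_pow[OF group_hom_snd])
  ultimately obtain w where w: "w \<in> carrier V" "x [^]\<^bsub>G\<^esub> ?d = (w, \<one>\<^bsub>H\<^esub>)"
    by (cases "x [^]\<^bsub>G\<^esub> ?d") (auto simp: semidirect_def)
  have "x [^]\<^bsub>G\<^esub> (?d * order V) = (w, \<one>\<^bsub>H\<^esub>) [^]\<^bsub>G\<^esub> order V"
    using x w by (simp flip: G.nat_pow_pow)
  also have "\<dots> = (w [^]\<^bsub>V\<^esub> order V, \<one>\<^bsub>H\<^esub>)" using group_hom.hom_nat_pow[OF group_hom_inl, OF w(1)] by simp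
  also have "\<dots> = \<one>\<^bsub>G\<^esub>" using V.pow_order_eq_1[OF w(1)] by (simp add: semidirect_def)
  finally have "G.ord x dvd ?d * order V" using x G.pow_eq_id by blast
  then show "G.ord x dvd ?d" using assms(2) by (simp add: coprime_dvd_mult_left_iff)
qed (rule group_hom.ord_hom_dvd[OF group_hom_snd, OF x])

lemma exists_ord_VV:
  assumes "prime p" "prime q" "p \<noteq> q" "p dvd order V" "q dvd order V"
  shows "\<exists>x \<in> carrier G. G.ord x = p * q"
  using V.exists_ord_mult_comm[OF finite_V assms] ord_inl group_hom.hom_closed[OF group_hom_inl] by metis

lemma exists_ord_HH_iff:
  assumes "p dvd order H" "q dvd order H"
  shows "(\<exists>x \<in> carrier G. G.ord x = p * q) \<longleftrightarrow> (\<exists>h \<in> carrier H. H.ord h = p * q)"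
proof
  have "coprime (p * q) (order V)"
    using assms coprime_order by (meson coprime_commute coprime_divisors coprime_mult_left_iff dvd_refl)
  then show "\<exists>x \<in> carrier G. G.ord x = p * q \<Longrightarrow> \<exists>h \<in> carrier H. H.ord h = p * q"
    using ord_snd group_hom.hom_closed[OF group_hom_snd] by metis
  show "\<exists>h \<in> carrier H. H.ord h = p * q \<Longrightarrow> \<exists>x \<in> carrier G. G.ord x = p * q"
    using ord_inr group_hom.hom_closed[OF group_hom_inr] by metis
qed

text \<open>An element of order \<open>p * q\<close> has commuting powers of orders \<open>p\<close>
  and \<open>q\<close>. The first lies in \<open>V\<close>, the second maps to an element
  \<open>h\<close> of order \<open>q\<close>, and their commuting means that \<open>h\<close> fixes
  the first.\<close>

lemma exists_ord_VH_iff: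
  assumes pq: "prime p" "prime q" and p: "p dvd order V" and q: "q dvd order H"
  shows "(\<exists>x \<in> carrier G. G.ord x = p * q) \<longleftrightarrow>
    (\<exists>h \<in> carrier H. \<exists>v \<in> carrier V. H.ord h = q \<and> V.ord v = p \<and> act h v = v)"
proof
  have cop: "coprime q (order V)" "coprime p (order H)"
    using p q coprime_order by (meson coprime_commute coprime_divisors dvd_refl)+
  have "p \<noteq> q" using cop p pq by (metis coprime_absorb_left not_prime_unit)
  assume "\<exists>x \<in> carrier G. G.ord x = p * q"
  then obtain x where x: "x \<in> carrier G" "G.ord x = p * q" by blast
  have pos: "p \<noteq> 0" "q \<noteq> 0" using pq by auto
  let ?y = "x [^]\<^bsub>G\<^esub> q" and ?z = "x [^]\<^bsub>G\<^esub> p"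
  have yz: "?y \<in> carrier G" "?z \<in> carrier G" using x by auto
  have ord: "G.ord ?y = p" "G.ord ?z = q" using x pos by (auto simp: G.ord_pow)
  have "H.ord (snd ?y) dvd p" using group_hom.ord_hom_dvd[OF group_hom_snd, OF yz(1)] ord by simp
  moreover have "H.ord (snd ?y) dvd order H"
    using group_hom.hom_closed[OF group_hom_snd, OF yz(1)] H.pow_order_eq_1 H.pow_eq_id by simp
  ultimately have "H.ord (snd ?y) = 1"
    using cop(2) by (metis coprime_common_divisor_nat)
  then have "snd ?y = \<one>\<^bsub>H\<^esub>" using group_hom.hom_closed[OF group_hom_snd, OF yz(1)] H.ord_eq_1 by simp
  then obtain v where v: "v \<in> carrier V" "?y = (v, \<one>\<^bsub>H\<^esub>)"
    using yz by (cases ?y) (auto simp: semidirect_def)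
  obtain w h where wh: "w \<in> carrier V" "h \<in> carrier H" "?z = (w, h)"
    using yz by (cases ?z) (auto simp: semidirect_def)
  \<comment> \<open>In the first components of the two products \<open>w\<close> cancels, because
    \<open>V\<close> is commutative.\<close>
  have "?y \<otimes>\<^bsub>G\<^esub> ?z = ?z \<otimes>\<^bsub>G\<^esub> ?y" using x by (simp add: G.nat_pow_mult add.commute)
  then have "v \<otimes>\<^bsub>V\<^esub> w = w \<otimes>\<^bsub>V\<^esub> act h v"
    using v wh by (simp add: semidirect_def)
  then have "w \<otimes>\<^bsub>V\<^esub> act h v = w \<otimes>\<^bsub>V\<^esub> v" using v wh by (simp add: V.m_comm)
  then have "act h v = v" using v wh by simp
  moreover have "V.ord v = p" using v ord by simp
  moreover have "H.ord h = q" using ord_snd[OF yz(2)] ord(2) cop(1) wh by simp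
  ultimately show "\<exists>h \<in> carrier H. \<exists>v \<in> carrier V. H.ord h = q \<and> V.ord v = p \<and> act h v = v"
    using v wh by blast
next
  have "p \<noteq> q" using p q pq coprime_order
    by (meson coprime_common_divisor not_prime_unit)
  assume "\<exists>h \<in> carrier H. \<exists>v \<in> carrier V. H.ord h = q \<and> V.ord v = p \<and> act h v = v"
  then obtain h v where hv: "h \<in> carrier H" "v \<in> carrier V" "H.ord h = q" "V.ord v = p" "act h v = v" by blast
  have "(v, \<one>\<^bsub>H\<^esub>) \<in> carrier G" "(\<one>\<^bsub>V\<^esub>, h) \<in> carrier G"
    "(v, \<one>\<^bsub>H\<^esub>) \<otimes>\<^bsub>G\<^esub> (\<one>\<^bsub>V\<^esub>, h) = (\<one>\<^bsub>V\<^esub>, h) \<otimes>\<^bsub>G\<^esub> (v, \<one>\<^bsub>H\<^esub>)"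
    using hv by (simp_all add: semidirect_def)
  then have "G.ord ((v, \<one>\<^bsub>H\<^esub>) \<otimes>\<^bsub>G\<^esub> (\<one>\<^bsub>V\<^esub>, h)) = p * q"
    by (rule G.ord_mult_commuting_primes) (use hv pq \<open>p \<noteq> q\<close> in simp_all)
  then show "\<exists>x \<in> carrier G. G.ord x = p * q"
    using hv by (meson G.m_closed group_hom.hom_closed[OF group_hom_inl] group_hom.hom_closed[OF group_hom_inr])
qed

end

section \<open>Semidirect products of two cyclic groups\<close>

lemma prime_graph_arcs_iff:
  "(p, q) \<in> parcs (prime_graph G) \<longleftrightarrow> p \<in> prime_factors (order G) \<and> q \<in> prime_factors (order G) \<and>
     p \<noteq> q \<and> (\<exists>x \<in> carrier G. group.ord G x = p * q)"
  by (simp add: prime_graph_def)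

lemma order_integer_mod_group: "0 < n \<Longrightarrow> order (integer_mod_group n) = n"
  by (simp add: order_def carrier_integer_mod_group)

text \<open>\<open>p * x\<close> vanishes modulo \<open>p * k\<close> exactly when \<open>k\<close>
  divides \<open>x\<close>.\<close>

lemma ord_integer_mod_group_prime:
  assumes "0 < k" "prime p" "x \<in> carrier (integer_mod_group (p * k))"
  shows "group.ord (integer_mod_group (p * k)) x = p \<longleftrightarrow> x \<noteq> 0 \<and> int k dvd x"
proof -
  interpret Z: group "integer_mod_group (p * k)" by simp
  have p: "0 < p" using assms(2) by (simp add: prime_gt_0_nat)
  have "x [^]\<^bsub>integer_mod_group (p * k)\<^esub> p = 0 \<longleftrightarrow> int (p * k) dvd int p * x"
    by (simp add: mod_eq_0_iff_dvd)
  also have "\<dots> \<longleftrightarrow> int k dvd x" using p by simp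
  finally have pow: "x [^]\<^bsub>integer_mod_group (p * k)\<^esub> p = 0 \<longleftrightarrow> int k dvd x" .
  show ?thesis
  proof
    assume ord: "Z.ord x = p"
    then have "x [^]\<^bsub>integer_mod_group (p * k)\<^esub> p = 0" using Z.pow_ord_eq_1[OF assms(3)] by simp
    moreover have "x \<noteq> 0" using ord Z.ord_id assms(2) by auto
    ultimately show "x \<noteq> 0 \<and> int k dvd x" using pow by blast
  next
    assume "x \<noteq> 0 \<and> int k dvd x"
    then show "Z.ord x = p" using pow assms by (intro Z.ord_eqI_prime) simp_all
  qed
qed

text \<open>The generator 1 of the acting cyclic group multiplies by \<open>u\<close>; residues are
  nonnegative representatives, so \<open>nat j\<close> loses nothing.\<close>

definition power_action :: "nat \<Rightarrow> int \<Rightarrow> int \<Rightarrow> int \<Rightarrow> int" where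
  "power_action n u j x = (u ^ nat j * x) mod int n"

definition metacyclic :: "nat \<Rightarrow> nat \<Rightarrow> int \<Rightarrow> (int \<times> int) monoid" where
  "metacyclic n m u = semidirect (integer_mod_group n) (integer_mod_group m) (power_action n u)"

text \<open>Split \<open>k\<close> into \<open>m * (k div m)\<close> and the remainder. This makes
  multiplication by powers of \<open>u\<close> an action of the integers modulo
  \<open>m\<close>.\<close>

lemma cong_power_mod_exponent:
  fixes u :: int
  assumes "[u ^ m = 1] (mod n)"
  shows "[u ^ (k mod m) = u ^ k] (mod n)"
proof -
  have "[u ^ (m * (k div m)) = 1] (mod n)"
    using cong_pow[OF assms, of "k div m"] by (simp add: power_mult)
  then have "[u ^ (k mod m) * 1 = u ^ (k mod m) * u ^ (m * (k div m))] (mod n)"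
    by (intro cong_scalar_left) (rule cong_sym)
  moreover have "u ^ (k mod m) * u ^ (m * (k div m)) = u ^ k" by (simp flip: power_add)
  ultimately show ?thesis by simp
qed

lemma coprime_action_power:
  assumes "0 < n" "0 < m" "coprime n m" "[u ^ m = 1] (mod int n)"
  shows "coprime_action (integer_mod_group n) (integer_mod_group m) (power_action n u)"
proof (intro coprime_action.intro coprime_action_axioms.intro abelian_integer_mod_group group_integer_mod_group)
  fix h k v w
  assume h: "h \<in> carrier (integer_mod_group m)" and v: "v \<in> carrier (integer_mod_group n)"
  show "power_action n u h v \<in> carrier (integer_mod_group n)"
    using assms(1) by (simp add: power_action_def carrier_integer_mod_group)
  show "power_action n u h (v \<otimes>\<^bsub>integer_mod_group n\<^esub> w) =
      power_action n u h v \<otimes>\<^bsub>integer_mod_group n\<^esub> power_action n u h w"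
    by (simp add: power_action_def mod_mult_right_eq mod_add_eq distrib_left)
  assume k: "k \<in> carrier (integer_mod_group m)"
  have "nat ((h + k) mod int m) = (nat h + nat k) mod m"
    using h k assms(2) by (simp add: carrier_integer_mod_group nat_mod_distrib nat_add_distrib)
  then have "[u ^ nat ((h + k) mod int m) = u ^ nat h * u ^ nat k] (mod int n)"
    using cong_power_mod_exponent[OF assms(4), of "nat h + nat k"] by (simp add: power_add)
  then have "[u ^ nat ((h + k) mod int m) * v = u ^ nat h * u ^ nat k * v] (mod int n)"
    by (rule cong_scalar_right)
  then show "power_action n u (h \<otimes>\<^bsub>integer_mod_group m\<^esub> k) v = power_action n u h (power_action n u k v)"
    by (simp add: power_action_def cong_def mod_mult_right_eq mult.assoc)
next
  fix v assume "v \<in> carrier (integer_mod_group n)"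
  then show "power_action n u \<one>\<^bsub>integer_mod_group m\<^esub> v = v"
    using assms(1) by (simp add: power_action_def carrier_integer_mod_group)
qed (use assms in \<open>simp_all add: order_integer_mod_group carrier_integer_mod_group\<close>)

text \<open>Every element of order \<open>q\<close> generates the same subgroup as
  \<open>m div q\<close>, so it fixes the same elements. On elements of order \<open>p\<close>,
  which are multiples of \<open>n div p\<close>, a multiplier only matters modulo
  \<open>p\<close>.\<close>

lemma power_action_fixed_point_iff:
  assumes "0 < n" "0 < m" "[u ^ m = 1] (mod int n)"
    and pq: "prime p" "prime q" "p dvd n" "q dvd m"
  shows "(\<exists>h \<in> carrier (integer_mod_group m). \<exists>v \<in> carrier (integer_mod_group n).
      group.ord (integer_mod_group m) h = q \<and> group.ord (integer_mod_group n) v = p \<and> power_action n u h v = v)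
    \<longleftrightarrow> int p dvd u ^ (m div q) - 1" (is "?L \<longleftrightarrow> ?R")
proof -
  obtain k where n: "n = p * k" using pq by blast
  obtain l where m: "m = q * l" using pq by blast
  have pos: "0 < p" "0 < k" "0 < q" "0 < l" using assms(1,2) n m by auto
  have ml: "m div q = l" using m pos by simp
  have fix_iff: "power_action n u h v = v \<longleftrightarrow> int n dvd (u ^ nat h - 1) * v"
    if "v \<in> carrier (integer_mod_group n)" for h v
  proof -
    have "v = v mod int n" using that assms(1) by (simp add: carrier_integer_mod_group)
    then have "power_action n u h v = v \<longleftrightarrow> (u ^ nat h * v) mod int n = v mod int n"
      by (simp add: power_action_def)
    then show ?thesis by (simp add: mod_eq_dvd_iff left_diff_distrib)
  qed
  show ?thesis
  proof
    assume ?L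
    then obtain h v where hv: "h \<in> carrier (integer_mod_group m)" "v \<in> carrier (integer_mod_group n)"
      "group.ord (integer_mod_group m) h = q" "group.ord (integer_mod_group n) v = p"
      "power_action n u h v = v" by blast
    have "h \<noteq> 0 \<and> int l dvd h" "v \<noteq> 0 \<and> int k dvd v"
      using hv ord_integer_mod_group_prime[of l q h] ord_integer_mod_group_prime[of k p v] pos pq n m by simp_all
    then obtain s t where st: "h = int l * s" "v = int k * t" "s \<noteq> 0" "t \<noteq> 0" by (auto elim!: dvdE)
    have h0: "0 \<le> h" "h < int q * int l" and v0: "0 \<le> v" "v < int p * int k"
      using hv(1,2) assms(1,2) n m by (simp_all add: carrier_integer_mod_group)
    have s: "0 < s" "s < int q" and t: "0 < t" "t < int p"
      using h0 v0 st pos by (simp_all add: zero_le_mult_iff mult.commute)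
    have "int n dvd (u ^ nat h - 1) * v" using fix_iff hv by blast
    then have "int p dvd (u ^ nat h - 1) * t" using st n pos by (simp add: mult.left_commute[of _ "int k"])
    moreover have "\<not> int p dvd t" using t zdvd_imp_le by fastforce
    ultimately have "int p dvd u ^ nat h - 1" using pq(1) prime_dvd_mult_iff[of "int p"] by simp
    moreover have "nat h = l * nat s" using st s by (simp add: nat_mult_distrib)
    ultimately have us: "[(u ^ l) ^ nat s = 1] (mod int p)"
      by (simp add: cong_iff_dvd_diff power_mult)
    have "[u ^ m = 1] (mod int p)" using assms(3) n by (simp add: cong_modulus_mult)
    then have uq: "[(u ^ l) ^ q = 1] (mod int p)" using m by (simp add: power_mult mult.commute)
    have "\<not> q dvd nat s" using s by (auto dest: dvd_imp_le)
    then have "coprime (nat s) q" using pq(2) by (metis coprime_commute prime_imp_coprime)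
    \<comment> \<open>\<open>a\<close> inverts \<open>nat s\<close> modulo \<open>q\<close>, so the
      power \<open>a\<close> of \<open>(u ^ l) ^ nat s\<close> is \<open>u ^ l\<close> modulo
      \<open>p\<close>.\<close>
    then obtain a b where ab: "nat s * a = q * b + 1"
      using coprime_bezout_strong[of "nat s" q] prime_gt_1_nat[OF pq(2)] by auto
    have "[((u ^ l) ^ nat s) ^ a = 1] (mod int p)" using cong_pow[OF us, of a] by simp
    moreover have "[((u ^ l) ^ q) ^ b * u ^ l = 1 * u ^ l] (mod int p)"
      using cong_pow[OF uq, of b] by (intro cong_scalar_right) simp
    moreover have "((u ^ l) ^ nat s) ^ a = ((u ^ l) ^ q) ^ b * u ^ l"
    proof -
      have "((u ^ l) ^ nat s) ^ a = (u ^ l) ^ (q * b + 1)" by (simp only: power_mult[of "u ^ l" "nat s" a, symmetric] ab)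
      then show ?thesis by (simp only: power_add power_mult power_one_right)
    qed
    ultimately have "[u ^ l = 1] (mod int p)" by (metis cong_sym cong_trans mult_1)
    then show ?R using ml by (simp add: cong_iff_dvd_diff)
  next
    assume ?R
    then have "int n dvd (u ^ l - 1) * int k" using n ml by simp
    moreover have "int k \<in> carrier (integer_mod_group n)" "int l \<in> carrier (integer_mod_group m)"
      using n m pos prime_gt_1_nat[OF pq(1)] prime_gt_1_nat[OF pq(2)] by (simp_all add: carrier_integer_mod_group)
    ultimately show ?L
      using ord_integer_mod_group_prime[of l q "int l"] ord_integer_mod_group_prime[of k p "int k"] pos pq n m
        fix_iff[of "int k" "int l"] by (intro bexI[of _ "int l"] bexI[of _ "int k"]) simp_all
  qed
qed

text \<open>The edge relation for primes dividing \<open>n * m\<close>, in a form that evaluates on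
  numerals: primes on the same side are adjacent, primes on different sides are subject to the fixed
  point criterion.\<close>

definition metacyclic_adj :: "nat \<Rightarrow> nat \<Rightarrow> int \<Rightarrow> nat \<Rightarrow> nat \<Rightarrow> bool" where
  "metacyclic_adj n m u p q \<longleftrightarrow> p \<noteq> q \<and>
    (if p dvd n then q dvd n \<or> int p dvd u ^ (m div q) - 1 else q dvd m \<or> int q dvd u ^ (m div p) - 1)"

lemma metacyclic:
  assumes "0 < n" "0 < m" "coprime n m" "[u ^ m = 1] (mod int n)"
  shows group_metacyclic: "group (metacyclic n m u)"
    and finite_metacyclic: "finite (carrier (metacyclic n m u))"
    and solvable_metacyclic: "solvable (metacyclic n m u)"
    and order_metacyclic: "order (metacyclic n m u) = n * m"
    and prime_graph_metacyclic: "prime p \<Longrightarrow> prime q \<Longrightarrow> p dvd n * m \<Longrightarrow> q dvd n * m \<Longrightarrow>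
      (p, q) \<in> parcs (prime_graph (metacyclic n m u)) \<longleftrightarrow> metacyclic_adj n m u p q"
proof -
  interpret A: coprime_action "integer_mod_group n" "integer_mod_group m" "power_action n u"
    using assms by (rule coprime_action_power)
  interpret Hc: comm_group "integer_mod_group m" by simp
  show "group (metacyclic n m u)" "finite (carrier (metacyclic n m u))" "solvable (metacyclic n m u)"
    unfolding metacyclic_def using A.group_semidirect A.finite_semidirect A.solvable_semidirect Hc.comm_group_solvable
    by blast+
  show ord: "order (metacyclic n m u) = n * m"
    unfolding metacyclic_def using assms by (simp add: A.order_semidirect order_integer_mod_group)
  assume pq: "prime p" "prime q" and dvd: "p dvd n * m" "q dvd n * m"
  have pf: "p \<in> prime_factors (n * m)" "q \<in> prime_factors (n * m)"
    using pq dvd assms by (simp_all add: prime_factors_dvd)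
  have dvd': "p dvd n \<or> p dvd m" "q dvd n \<or> q dvd m" using pq dvd prime_dvd_mult_iff by blast+
  have nd: "\<not> (p dvd n \<and> p dvd m)" "\<not> (q dvd n \<and> q dvd m)"
    using pq assms(3) coprime_common_divisor not_prime_unit by blast+
  have orders: "order (integer_mod_group n) = n" "order (integer_mod_group m) = m"
    using assms by (simp_all add: order_integer_mod_group)
  have fins: "finite (carrier (integer_mod_group m))" by (rule A.finite_H)
  let ?X = "\<exists>x \<in> carrier (metacyclic n m u). group.ord (metacyclic n m u) x = p * q"
  have "?X \<longleftrightarrow> metacyclic_adj n m u p q" if "p \<noteq> q"
  proof (cases "p dvd n")
    case True
    show ?thesis
    proof (cases "q dvd n")
      case True': True
      then show ?thesis
        using A.exists_ord_VV[of p q] pq that True orders by (simp add: metacyclic_adj_def metacyclic_def)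
    next
      case False
      then show ?thesis
        using A.exists_ord_VH_iff[of p q] power_action_fixed_point_iff[OF assms(1,2,4) pq] pq True dvd' that orders
        by (simp add: metacyclic_adj_def metacyclic_def)
    qed
  next
    case False
    show ?thesis
    proof (cases "q dvd n")
      case True
      then have "\<not> q dvd m" using nd by blast
      moreover have "p dvd m" using False dvd' by blast
      ultimately show ?thesis
        using A.exists_ord_VH_iff[of q p] power_action_fixed_point_iff[OF assms(1,2,4) pq(2,1)] pq True False that orders
        by (simp add: metacyclic_adj_def metacyclic_def mult.commute)
    next
      case False': False
      then have "p dvd m" "q dvd m" using False dvd' by auto
      then show ?thesis
        using A.exists_ord_HH_iff[of p q] Hc.exists_ord_mult_comm[OF fins pq that] False that orders
        by (simp add: metacyclic_adj_def metacyclic_def)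
    qed
  qed
  then show "(p, q) \<in> parcs (prime_graph (metacyclic n m u)) \<longleftrightarrow> metacyclic_adj n m u p q"
    using pf ord by (auto simp: prime_graph_arcs_iff metacyclic_adj_def)
qed

section \<open>Realization\<close>

lemma prime_factors_prod_list_primes:
  assumes "\<And>p. p \<in> set ps \<Longrightarrow> prime (p :: nat)"
  shows "prime_factors (prod_list ps) = set ps"
  using assms
proof (induction ps)
  case (Cons p ps)
  have "0 \<notin> set ps" using Cons.prems not_prime_0 by (metis list.set_intros(2))
  then have "prod_list ps \<noteq> 0" by (simp add: prod_list_zero_iff)
  moreover have "prime p" using Cons.prems by simp
  moreover from this have "p \<noteq> 0" by auto
  ultimately show ?case
    using Cons by (simp add: prime_factors_product prime_prime_factors)
qed simp

text \<open>The list \<open>ps\<close> assigns a prime to each vertex. For numerals all hypotheses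
  are finite arithmetic that the simplifier settles.\<close>

lemma metacyclic_occurs:
  assumes nm: "0 < n" "0 < m" "coprime n m" "[u ^ m = 1] (mod int n)"
    and ps: "n * m = prod_list ps" "distinct ps" "\<forall>p \<in> set ps. prime p"
    and A: "\<forall>e \<in> A. fst e \<noteq> snd e" "\<forall>i \<in> {..<length ps}. \<forall>j \<in> {..<length ps}.
      metacyclic_adj n m u (ps ! i) (ps ! j) \<longleftrightarrow> (i, j) \<in> A \<or> (j, i) \<in> A"
  shows "occurs_as_solvable_prime_graph (graph_on (length ps) A)"
proof (rule occurs_as_solvable_prime_graphI)
  note G = group_metacyclic[OF nm] finite_metacyclic[OF nm] solvable_metacyclic[OF nm]
  show "group (metacyclic n m u)" "finite (carrier (metacyclic n m u))" "solvable (metacyclic n m u)"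
    using G by blast+
  have verts: "pverts (prime_graph (metacyclic n m u)) = set ps"
    using ps order_metacyclic[OF nm] prime_factors_prod_list_primes by (simp add: prime_graph_def)
  have "p dvd n * m" if "p \<in> set ps" for p using that ps(1) by (simp add: prod_list_dvd)
  then have "listing (prime_graph (metacyclic n m u)) (length ps) A ps"
    using ps A verts by (auto simp: listing_def prime_graph_metacyclic[OF nm])
  moreover have "irrefl A" using A(1) by (auto simp: irrefl_def)
  ultimately show "digraph_iso (with_proj (prime_graph (metacyclic n m u))) (with_proj (graph_on (length ps) A))"
    using pair_graph_prime_graph listing_digraph_iso(1) by blast
qed

lemma small_forests_occur:
  assumes "(n, A) \<in> small_forests"
  shows "occurs_as_solvable_prime_graph (graph_on n A)"
proof -
  note simps = metacyclic_adj_def cong_def lessThan_nat_numeral lessThan_Suc coprime_iff_gcd_eq_1 gcd_non_0_nat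
  \<comment> \<open>The numbers given are \<open>n\<close>, \<open>m\<close> and \<open>u\<close>.
    As \<open>m\<close> is squarefree, primes \<open>p\<close> of \<open>n\<close> and
    \<open>q\<close> of \<open>m\<close> are joined exactly when \<open>q\<close> does not divide
    the order of \<open>u\<close> modulo \<open>p\<close>; so \<open>u\<close> is chosen by its
    orders modulo the primes of \<open>n\<close>.\<close>
  have "occurs_as_solvable_prime_graph (graph_on (length [2 :: nat]) {})"
    by (rule metacyclic_occurs[of 2 1 1]) (simp_all add: simps)
  moreover have "occurs_as_solvable_prime_graph (graph_on (length [2, 3 :: nat]) {(0, 1)})"
    by (rule metacyclic_occurs[of 6 1 1]) (simp_all add: simps)
  moreover have "occurs_as_solvable_prime_graph (graph_on (length [2, 3 :: nat]) {})"
    by (rule metacyclic_occurs[of 3 2 2]) (simp_all add: simps)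
  moreover have "occurs_as_solvable_prime_graph (graph_on (length [2, 5, 3 :: nat]) {(0, 1), (1, 2)})"
    by (rule metacyclic_occurs[of 15 2 11]) (simp_all add: simps)
  moreover have "occurs_as_solvable_prime_graph (graph_on (length [3, 5, 2 :: nat]) {(0, 1)})"
    by (rule metacyclic_occurs[of 15 2 14]) (simp_all add: simps)
  \<comment> \<open>24 has order 2 modulo 5 and order 6 modulo 7, so 3 and 5 are the only primes of
    different sides that are joined.\<close>
  moreover have "occurs_as_solvable_prime_graph (graph_on (length [2, 3, 5, 7 :: nat]) {(0, 1), (1, 2), (2, 3)})"
    by (rule metacyclic_occurs[of 35 6 24]) (simp_all add: simps)
  \<comment> \<open>17 has order 6 modulo both 7 and 13, so no edge joins the two sides.\<close>
  moreover have "occurs_as_solvable_prime_graph (graph_on (length [2, 3, 7, 13 :: nat]) {(0, 1), (2, 3)})"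
    by (rule metacyclic_occurs[of 91 6 17]) (simp_all add: simps)
  ultimately show ?thesis
    using assms by (auto simp: small_forests_def numeral_eq_Suc)
qed

lemma cycle_graph_4_occurs: "occurs_as_solvable_prime_graph (cycle_graph 4)"
proof -
  note simps = metacyclic_adj_def cong_def lessThan_nat_numeral lessThan_Suc coprime_iff_gcd_eq_1 gcd_non_0_nat
  \<comment> \<open>14 has order 2 modulo 3 and order 5 modulo 11, so 3 is joined to 5 and 11 to
    2.\<close>
  have "occurs_as_solvable_prime_graph (graph_on (length [2, 5, 3, 11 :: nat]) {(0, 1), (1, 2), (2, 3), (3, 0)})"
    by (rule metacyclic_occurs[of 33 10 14]) (simp_all add: simps)
  then show ?thesis unfolding cycle_graph_4 by (simp add: numeral_eq_Suc)
qed


section \<open>A group whose prime graph is the 5-cycle\<close>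

lemma comm_group_DirProd:
  assumes "comm_group G" "comm_group H"
  shows "comm_group (G \<times>\<times> H)"
proof -
  interpret G: comm_group G by (rule assms)
  interpret H: comm_group H by (rule assms)
  show ?thesis
    by (rule group.group_comm_groupI[OF DirProd_group[OF G.is_group H.is_group]])
      (auto simp: G.m_comm H.m_comm)
qed

text \<open>The subgroup of order 15 in the complement acts on the two copies of the field with 31 elements by
  mutually conjugate characters of order 15, namely 10 and \<open>19 \<equiv> 10 ^ 11\<close>, and on that with 11 by
  its quotient of order 5. The involution inverts the elements of order 3, swaps the two copies and
  negates the last coordinate.\<close>

definition pentagon_kernel :: "(int \<times> int \<times> int) monoid" where
  "pentagon_kernel = integer_mod_group 31 \<times>\<times> integer_mod_group 31 \<times>\<times> integer_mod_group 11"

fun pentagon_action :: "int \<times> int \<Rightarrow> int \<times> int \<times> int \<Rightarrow> int \<times> int \<times> int" where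
  "pentagon_action (j, s) (x, y, z) =
    (if s = 0 then ((10 ^ nat j * x) mod 31, (19 ^ nat j * y) mod 31, (3 ^ nat j * z) mod 11)
     else ((10 ^ nat j * y) mod 31, (19 ^ nat j * x) mod 31, (- (3 ^ nat j) * z) mod 11))"

text \<open>Since 11 is 1 modulo 5 and -1 modulo 3, this is the product of the symmetric group on
  three letters and a cyclic group of order 5.\<close>

abbreviation "pentagon_complement \<equiv> metacyclic 15 2 11"

abbreviation "pentagon_group \<equiv> semidirect pentagon_kernel pentagon_complement pentagon_action"

lemma carrier_pentagon_kernel:
  "carrier pentagon_kernel = {0..<31} \<times> {0..<31} \<times> {0..<11}"
  by (simp add: pentagon_kernel_def carrier_integer_mod_group)

lemma mult_pentagon_kernel:
  "(x, y, z) \<otimes>\<^bsub>pentagon_kernel\<^esub> (x', y', z') = ((x + x') mod 31, (y + y') mod 31, (z + z') mod 11)"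
  by (simp add: pentagon_kernel_def)

lemma one_pentagon_kernel: "\<one>\<^bsub>pentagon_kernel\<^esub> = (0, 0, 0)"
  by (simp add: pentagon_kernel_def)

lemma carrier_pentagon_complement: "carrier pentagon_complement = {0..<15} \<times> {0..<2}"
  by (simp add: metacyclic_def semidirect_def carrier_integer_mod_group)

lemma mult_pentagon_complement:
  "(j, s) \<otimes>\<^bsub>pentagon_complement\<^esub> (k, t) = ((j + (11 ^ nat s * k) mod 15) mod 15, (s + t) mod 2)"
  by (simp add: metacyclic_def semidirect_def power_action_def)

lemma one_pentagon_complement: "\<one>\<^bsub>pentagon_complement\<^esub> = (0, 0)"
  by (simp add: metacyclic_def semidirect_def)

lemma pow_pentagon_kernel:
  "(x, y, z) [^]\<^bsub>pentagon_kernel\<^esub> (n :: nat) = ((int n * x) mod 31, (int n * y) mod 31, (int n * z) mod 11)"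
  by (induction n)
    (simp_all add: one_pentagon_kernel mult_pentagon_kernel algebra_simps mod_add_left_eq mod_add_right_eq)

text \<open>Exponents of \<open>c\<close> count modulo 15. Moving the involution past
  \<open>k\<close> multiplies \<open>k\<close> by 11, which turns the character \<open>c\<close>
  into \<open>d\<close>; these are the two cases of the composition law.\<close>

lemma power_mod_15:
  fixes c :: int
  assumes c: "[c ^ 15 = 1] (mod N)" "0 \<le> j" "0 \<le> k"
  shows "[c ^ nat ((j + k mod 15) mod 15) = c ^ nat j * c ^ nat k] (mod N)"
    and "[c ^ 11 = d] (mod N) \<Longrightarrow> [c ^ nat ((j + (11 * k) mod 15) mod 15) = c ^ nat j * d ^ nat k] (mod N)"
proof -
  have *: "[c ^ nat ((j + l mod 15) mod 15) = c ^ nat j * c ^ nat l] (mod N)" if "0 \<le> l" for l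
  proof -
    have "nat ((j + l mod 15) mod 15) = (nat j + nat l) mod 15"
      using c that by (simp add: mod_add_right_eq nat_mod_distrib nat_add_distrib)
    then show ?thesis using cong_power_mod_exponent[OF c(1), of "nat j + nat l"] by (simp add: power_add)
  qed
  show "[c ^ nat ((j + k mod 15) mod 15) = c ^ nat j * c ^ nat k] (mod N)" using * c by blast
  assume d: "[c ^ 11 = d] (mod N)"
  have "c ^ nat (11 * k) = (c ^ 11) ^ nat k" using c by (simp add: nat_mult_distrib power_mult)
  then have "[c ^ nat (11 * k) = d ^ nat k] (mod N)" using cong_pow[OF d] by simp
  then show "[c ^ nat ((j + (11 * k) mod 15) mod 15) = c ^ nat j * d ^ nat k] (mod N)"
    using *[of "11 * k"] c cong_scalar_left cong_trans by (metis mult_nonneg_nonneg zero_le_numeral)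
qed

text \<open>The four sign patterns arise in the last coordinate, which is negated once for each
  factor that contains the involution.\<close>

lemma mod_mult_mult_mod:
  fixes a :: int
  assumes "[a = b * c] (mod N)"
  shows "(a * x) mod N = (b * ((c * x) mod N)) mod N"
    and "(- a * x) mod N = (- b * ((c * x) mod N)) mod N"
    and "(- a * x) mod N = (b * ((- c * x) mod N)) mod N"
    and "(a * x) mod N = (- b * ((- c * x) mod N)) mod N"
proof -
  have *: "(a' * x) mod N = (b' * ((c' * x) mod N)) mod N" if "[a' = b' * c'] (mod N)" for a' b' c'
    using cong_scalar_right[OF that, of x] by (simp add: cong_def mod_mult_right_eq mult.assoc)
  have "[- a = - (b * c)] (mod N)" using assms by (simp only: cong_minus_minus_iff)
  then show "(- a * x) mod N = (- b * ((c * x) mod N)) mod N"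
    "(- a * x) mod N = (b * ((- c * x) mod N)) mod N"
    by (intro *; simp)+
  show "(a * x) mod N = (b * ((c * x) mod N)) mod N" "(a * x) mod N = (- b * ((- c * x) mod N)) mod N"
    using assms by (intro *; simp)+
qed

lemma pentagon_complement_valid: "0 < (15 :: nat)" "0 < (2 :: nat)" "coprime (15 :: nat) 2" "[11 ^ 2 = (1 :: int)] (mod int 15)"
  by (simp_all add: coprime_iff_gcd_eq_1 gcd_non_0_nat cong_def)

lemmas pentagon_complement_props =
  group_metacyclic[OF pentagon_complement_valid] finite_metacyclic[OF pentagon_complement_valid]
  solvable_metacyclic[OF pentagon_complement_valid] order_metacyclic[OF pentagon_complement_valid]

lemma coprime_action_pentagon: "coprime_action pentagon_kernel pentagon_complement pentagon_action"
proof (intro coprime_action.intro coprime_action_axioms.intro)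
  show "comm_group pentagon_kernel"
    unfolding pentagon_kernel_def by (intro comm_group_DirProd abelian_integer_mod_group)
  show "group pentagon_complement" "finite (carrier pentagon_complement)"
    by (rule pentagon_complement_props)+
  show "finite (carrier pentagon_kernel)" by (simp add: carrier_pentagon_kernel)
  have "order pentagon_kernel = 31 * (31 * 11)"
    by (simp add: order_def carrier_pentagon_kernel card_cartesian_product)
  then show "coprime (order pentagon_kernel) (order pentagon_complement)"
    by (simp add: pentagon_complement_props coprime_iff_gcd_eq_1 gcd_non_0_nat)
  fix h k v w
  assume h: "h \<in> carrier pentagon_complement" and v: "v \<in> carrier pentagon_kernel"
  obtain j s x y z where hv: "h = (j, s)" "v = (x, y, z)" by (metis surj_pair)
  show "pentagon_action h v \<in> carrier pentagon_kernel"
    using hv by (simp add: carrier_pentagon_kernel)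
  show "pentagon_action h (v \<otimes>\<^bsub>pentagon_kernel\<^esub> w) =
      pentagon_action h v \<otimes>\<^bsub>pentagon_kernel\<^esub> pentagon_action h w"
    using hv by (cases w)
      (simp add: mult_pentagon_kernel mod_mult_right_eq mod_add_eq distrib_left
        mod_diff_eq mod_minus_eq mult_minus_right flip: mult_minus_left)
  assume k: "k \<in> carrier pentagon_complement"
  obtain l t where kt: "k = (l, t)" by (metis surj_pair)
  have j: "0 \<le> j" "0 \<le> l" and s: "s = 0 \<or> s = 1" "t = 0 \<or> t = 1"
    using h k hv kt by (auto simp: carrier_pentagon_complement)
  \<comment> \<open>The power 11 exchanges the characters 10 and 19, matching the swap of the first
    two coordinates, and fixes 3, which has order 5 modulo 11.\<close>
  have c: "[10 ^ 15 = 1] (mod 31 :: int)" "[19 ^ 15 = 1] (mod 31 :: int)" "[3 ^ 15 = 1] (mod 11 :: int)"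
    "[10 ^ 11 = 19] (mod 31 :: int)" "[19 ^ 11 = 10] (mod 31 :: int)" "[3 ^ 11 = 3] (mod 11 :: int)"
    by (simp_all add: cong_def)
  note m = power_mod_15(1)[OF c(1) j] power_mod_15(1)[OF c(2) j] power_mod_15(1)[OF c(3) j]
    power_mod_15(2)[OF c(1) j c(4)] power_mod_15(2)[OF c(2) j c(5)] power_mod_15(2)[OF c(3) j c(6)]
  have eq: "(j, s) \<otimes>\<^bsub>pentagon_complement\<^esub> (l, t) =
      (if s = 0 then ((j + l mod 15) mod 15, t) else ((j + (11 * l) mod 15) mod 15, 1 - t))"
    using s by (auto simp: mult_pentagon_complement)
  note simps = pentagon_action.simps simp_thms if_True if_False one_neq_zero diff_0_right diff_self
  show "pentagon_action (h \<otimes>\<^bsub>pentagon_complement\<^esub> k) v = pentagon_action h (pentagon_action k v)"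
    unfolding hv kt eq using s
    by (elim disjE)
      (simp_all only: simps m(1-5)[THEN mod_mult_mult_mod(1)] m(3)[THEN mod_mult_mult_mod(3)]
        m(6)[THEN mod_mult_mult_mod(2)] m(6)[THEN mod_mult_mult_mod(4)] minus_minus)
next
  fix v assume "v \<in> carrier pentagon_kernel"
  then show "pentagon_action \<one>\<^bsub>pentagon_complement\<^esub> v = v"
    by (cases v) (auto simp: one_pentagon_complement carrier_pentagon_kernel)
qed

interpretation pentagon: coprime_action pentagon_kernel pentagon_complement pentagon_action
  by (rule coprime_action_pentagon)

text \<open>The second component of the power \<open>n\<close> of \<open>(j, 1)\<close> is
  \<open>n\<close> modulo 2, so odd orders force \<open>s = 0\<close>, where powers are multiples of
  \<open>j\<close> modulo 15. The square of \<open>(j, 1)\<close> has first component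
  \<open>12 * j\<close> modulo 15, which settles order 2.\<close>

lemma pentagon_complement_ord:
  assumes "h \<in> carrier pentagon_complement" "h = (j, s)"
  shows "pentagon.H.ord h = 2 \<Longrightarrow> s = 1 \<and> j \<in> {0, 5, 10}"
    and "pentagon.H.ord h = 3 \<Longrightarrow> s = 0 \<and> j \<in> {5, 10}"
    and "pentagon.H.ord h = 5 \<Longrightarrow> s = 0 \<and> j \<in> {3, 6, 9, 12}"
proof -
  have js: "0 \<le> j" "j < 15" "s = 0 \<or> s = 1"
    using assms by (auto simp: carrier_pentagon_complement)
  have pow: "h [^]\<^bsub>pentagon_complement\<^esub> n = (0, 0)" if "pentagon.H.ord h = n" for n
    using that pentagon.H.pow_ord_eq_1[OF assms(1)] by (simp add: one_pentagon_complement)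
  have ne: "h \<noteq> (0, 0)" if "pentagon.H.ord h \<noteq> 1"
    using that pentagon.H.ord_id by (auto simp: one_pentagon_complement)
  have pow0: "(j, 0) [^]\<^bsub>pentagon_complement\<^esub> (n :: nat) = ((int n * j) mod 15, 0)" for n
    by (induction n) (simp_all add: one_pentagon_complement mult_pentagon_complement mod_simps algebra_simps)
  have pow1: "snd ((j, 1) [^]\<^bsub>pentagon_complement\<^esub> (n :: nat)) = int n mod 2" for n
  proof (induction n)
    case (Suc n)
    then show ?case
      by (cases "(j, 1) [^]\<^bsub>pentagon_complement\<^esub> n")
        (simp add: mult_pentagon_complement mod_simps add.commute)
  qed (simp add: one_pentagon_complement)
  have sq: "(j, 1) [^]\<^bsub>pentagon_complement\<^esub> (2 :: nat) = ((j + (11 * j) mod 15) mod 15, 0)"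
  proof -
    have "(j, 1) \<in> carrier pentagon_complement" using js by (simp add: carrier_pentagon_complement)
    then show ?thesis
      using pentagon.H.nat_pow_mult[of "(j, 1)" 1 1] by (simp add: mult_pentagon_complement numeral_2_eq_2[symmetric])
  qed
  show "s = 1 \<and> j \<in> {0, 5, 10}" if "pentagon.H.ord h = 2"
  proof -
    have "s \<noteq> 0"
    proof
      assume "s = 0"
      then have "(2 * j) mod 15 = 0" using pow[OF that] pow0[of 2] assms(2) by simp
      then have "j = 0" using js by presburger
      then show False using ne that \<open>s = 0\<close> assms(2) by simp
    qed
    then have "s = 1" using js by simp
    then have "(12 * j) mod 15 = 0" using pow[OF that] sq assms(2) by (simp add: mod_add_right_eq)
    then have "5 dvd j" by presburger
    then have "j = 0 \<or> j = 5 \<or> j = 10" using js by presburger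
    then show ?thesis using \<open>s = 1\<close> by blast
  qed
  have s0: "s = 0" if "pentagon.H.ord h = n" "odd n" for n
  proof (rule ccontr)
    assume "s \<noteq> 0"
    then have "s = 1" using js by blast
    then have "int n mod 2 = 0" using pow[OF that(1)] pow1[of n] assms(2) by simp
    then show False using that(2) by presburger
  qed
  show "s = 0 \<and> j \<in> {5, 10}" if "pentagon.H.ord h = 3"
  proof -
    have "s = 0" using s0 that by simp
    then have "(3 * j) mod 15 = 0" "j \<noteq> 0" using pow[OF that] pow0[of 3] ne that assms(2) by auto
    then have "5 dvd j" "j \<noteq> 0" by presburger+
    then have "j = 5 \<or> j = 10" using js by presburger
    then show ?thesis using \<open>s = 0\<close> by blast
  qed
  show "s = 0 \<and> j \<in> {3, 6, 9, 12}" if "pentagon.H.ord h = 5"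
  proof -
    have "s = 0" using s0 that by simp
    then have "(5 * j) mod 15 = 0" "j \<noteq> 0" using pow[OF that] pow0[of 5] ne that assms(2) by auto
    then have "3 dvd j" "j \<noteq> 0" by presburger+
    then have "j = 3 \<or> j = 6 \<or> j = 9 \<or> j = 12" using js by presburger
    then show ?thesis using \<open>s = 0\<close> by blast
  qed
qed

text \<open>A fixed point of multiplication by \<open>c\<close> is annihilated by
  \<open>c - 1\<close>, a unit modulo \<open>N\<close>.\<close>

lemma fixed_residue_eq_0:
  fixes x :: int
  assumes "(c * x) mod N = x" "coprime (c - 1) N" "0 \<le> x" "x < N"
  shows "x = 0"
proof -
  have "x mod N = x" using assms by simp
  then have "N dvd (c - 1) * x" using assms(1) by (simp add: left_diff_distrib flip: mod_eq_dvd_iff)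
  then have "N dvd x" using assms(2) by (simp add: coprime_commute coprime_dvd_mult_right_iff)
  then show ?thesis using assms(3,4) zdvd_not_zless[of x N] by force
qed

text \<open>31 is invertible modulo 11 and 11 modulo 31, so the coordinates belonging to the other
  prime vanish.\<close>

lemma pentagon_kernel_ord:
  assumes "v \<in> carrier pentagon_kernel" "v = (x, y, z)"
  shows "pentagon.V.ord v = 31 \<Longrightarrow> z = 0 \<and> (x \<noteq> 0 \<or> y \<noteq> 0)"
    and "pentagon.V.ord v = 11 \<Longrightarrow> x = 0 \<and> y = 0 \<and> z \<noteq> 0"
proof -
  have r: "0 \<le> x" "x < 31" "0 \<le> y" "y < 31" "0 \<le> z" "z < 11"
    using assms by (auto simp: carrier_pentagon_kernel)
  have pow: "v [^]\<^bsub>pentagon_kernel\<^esub> n = (0, 0, 0)" if "pentagon.V.ord v = n" for n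
    using that pentagon.V.pow_ord_eq_1[OF assms(1)] by (simp add: one_pentagon_kernel)
  have ne: "v \<noteq> (0, 0, 0)" if "pentagon.V.ord v \<noteq> 1"
    using that pentagon.V.ord_id by (auto simp: one_pentagon_kernel)
  show "z = 0 \<and> (x \<noteq> 0 \<or> y \<noteq> 0)" if "pentagon.V.ord v = 31"
  proof -
    have "(31 * z) mod 11 = 0" using pow[OF that] assms(2) by (simp add: pow_pentagon_kernel)
    then have "11 dvd 31 * z" by (simp add: dvd_eq_mod_eq_0)
    moreover have "coprime (11 :: int) 31" by (simp add: coprime_iff_gcd_eq_1 gcd_non_0_int)
    ultimately have "11 dvd z" by (simp add: coprime_dvd_mult_right_iff)
    then have "z = 0" using r zdvd_not_zless[of z 11] by force
    then show ?thesis using ne that assms(2) by auto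
  qed
  show "x = 0 \<and> y = 0 \<and> z \<noteq> 0" if "pentagon.V.ord v = 11"
  proof -
    have "(11 * x) mod 31 = 0" "(11 * y) mod 31 = 0"
      using pow[OF that] assms(2) by (simp_all add: pow_pentagon_kernel)
    then have "31 dvd 11 * x" "31 dvd 11 * y" by (simp_all add: dvd_eq_mod_eq_0)
    moreover have "coprime (31 :: int) 11" by (simp add: coprime_iff_gcd_eq_1 gcd_non_0_int)
    ultimately have "31 dvd x" "31 dvd y" by (simp_all add: coprime_dvd_mult_right_iff)
    then have "x = 0" "y = 0" using r zdvd_not_zless[of x 31] zdvd_not_zless[of y 31] by force+
    then show ?thesis using ne that assms(2) by auto
  qed
qed

text \<open>In each listed case \<open>h\<close> multiplies the relevant coordinates by constants,
  and each constant minus 1 is a unit modulo 31 or 11, so \<open>fixed_residue_eq_0\<close> leaves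
  only zero coordinates.\<close>

lemma pentagon_no_fixed_point:
  assumes "h \<in> carrier pentagon_complement" "v \<in> carrier pentagon_kernel"
    and "pentagon.H.ord h = q" "pentagon.V.ord v = p" "(p, q) \<in> {(31, 3), (31, 5), (11, 2), (11, 5)}"
  shows "pentagon_action h v \<noteq> v"
proof
  assume fixed: "pentagon_action h v = v"
  obtain j s x y z where hv: "h = (j, s)" "v = (x, y, z)" by (metis surj_pair)
  have r: "0 \<le> x" "x < 31" "0 \<le> y" "y < 31" "0 \<le> z" "z < 11"
    using assms(2) hv by (auto simp: carrier_pentagon_kernel)
  note oh = pentagon_complement_ord[OF assms(1) hv(1)] and ov = pentagon_kernel_ord[OF assms(2) hv(2)]
  note cop = coprime_iff_gcd_eq_1 gcd_non_0_int
  consider "q = 3 \<or> q = 5" "p = 31" | "q = 2" "p = 11" | "q = 5" "p = 11" using assms(5) by blast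
  then show False
  proof cases
    case 1
    then have "s = 0" "j \<in> {5, 10, 3, 6, 9, 12}" "x \<noteq> 0 \<or> y \<noteq> 0" using assms oh ov by auto
    then have "(10 ^ nat j * x) mod 31 = x" "(19 ^ nat j * y) mod 31 = y" using fixed hv by simp_all
    moreover have "coprime (10 ^ nat j - 1) (31 :: int)" "coprime (19 ^ nat j - 1) (31 :: int)"
      using \<open>j \<in> _\<close> by (elim insertE emptyE; simp add: cop)+
    ultimately show False using fixed_residue_eq_0 r \<open>x \<noteq> 0 \<or> y \<noteq> 0\<close> by metis
  next
    case 2
    then have "s = 1" "j \<in> {0, 5, 10}" "z \<noteq> 0" using assms oh ov by auto
    then have "(- (3 ^ nat j) * z) mod 11 = z" using fixed hv by simp
    moreover have "coprime (- (3 ^ nat j) - 1) (11 :: int)"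
      using \<open>j \<in> _\<close> by (elim insertE emptyE; simp add: cop)+
    ultimately show False using fixed_residue_eq_0 r \<open>z \<noteq> 0\<close> by metis
  next
    case 3
    then have "s = 0" "j \<in> {3, 6, 9, 12}" "z \<noteq> 0" using assms oh ov by auto
    then have "(3 ^ nat j * z) mod 11 = z" using fixed hv by simp
    moreover have "coprime (3 ^ nat j - 1) (11 :: int)"
      using \<open>j \<in> _\<close> by (elim insertE emptyE; simp add: cop)+
    ultimately show False using fixed_residue_eq_0 r \<open>z \<noteq> 0\<close> by metis
  qed
qed

lemma order_pentagon_kernel: "order pentagon_kernel = 31 * (31 * 11)"
  by (simp add: order_def carrier_pentagon_kernel card_cartesian_product)

lemma order_pentagon_complement: "order pentagon_complement = 30"
  by (simp add: pentagon_complement_props)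

lemma pentagon_exists_ord_iff:
  defines "ex p q \<equiv> \<exists>x \<in> carrier pentagon_group. group.ord pentagon_group x = p * q"
  shows "ex 31 11" "ex 31 2" "\<not> ex 31 3" "\<not> ex 31 5" "\<not> ex 11 2" "ex 11 3" "\<not> ex 11 5"
    "\<not> ex 2 3" "ex 2 5" "ex 3 5"
proof -
  show "ex 31 11"
    unfolding ex_def by (rule pentagon.exists_ord_VV) (simp_all add: order_pentagon_kernel)
  have VH: "ex p q \<longleftrightarrow> (\<exists>h \<in> carrier pentagon_complement. \<exists>v \<in> carrier pentagon_kernel.
      pentagon.H.ord h = q \<and> pentagon.V.ord v = p \<and> pentagon_action h v = v)"
    if "p \<in> {31, 11}" "q \<in> {2, 3, 5}" for p q
    unfolding ex_def using that
    by (intro pentagon.exists_ord_VH_iff) (auto simp: order_pentagon_kernel order_pentagon_complement)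
  show "\<not> ex 31 3" "\<not> ex 31 5" "\<not> ex 11 2" "\<not> ex 11 5"
    using pentagon_no_fixed_point by (auto simp: VH)
  \<comment> \<open>The fixed vectors for the two edges between kernel and complement: the swap
    fixes \<open>(1, 1, 0)\<close>, and \<open>(5, 0)\<close> fixes the last coordinate because
    \<open>3 ^ 5\<close> is 1 modulo 11.\<close>
  have mem: "(0, 1) \<in> carrier pentagon_complement" "(5, 0) \<in> carrier pentagon_complement"
    "(1, 1, 0) \<in> carrier pentagon_kernel" "(0, 0, 1) \<in> carrier pentagon_kernel"
    by (simp_all add: carrier_pentagon_complement carrier_pentagon_kernel)
  have "(0, 1) [^]\<^bsub>pentagon_complement\<^esub> (2 :: nat) = \<one>\<^bsub>pentagon_complement\<^esub>"
    using pentagon.H.nat_pow_mult[OF mem(1), of 1 1, symmetric] mem(1)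
    by (simp add: mult_pentagon_complement one_pentagon_complement numeral_2_eq_2[symmetric])
  moreover have "(5, 0) [^]\<^bsub>pentagon_complement\<^esub> (3 :: nat) = \<one>\<^bsub>pentagon_complement\<^esub>"
    using pentagon.H.nat_pow_mult[OF mem(2), of 1 1, symmetric]
      pentagon.H.nat_pow_mult[OF mem(2), of 2 1, symmetric] mem(2)
    by (simp add: mult_pentagon_complement one_pentagon_complement numeral_2_eq_2[symmetric])
  ultimately have ords: "pentagon.H.ord (0, 1) = 2" "pentagon.H.ord (5, 0) = 3"
    using mem by (intro pentagon.H.ord_eqI_prime; simp add: one_pentagon_complement)+
  have ords': "pentagon.V.ord (1, 1, 0) = 31" "pentagon.V.ord (0, 0, 1) = 11"
    using mem by (intro pentagon.V.ord_eqI_prime; simp add: one_pentagon_kernel pow_pentagon_kernel)+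
  have "pentagon_action (0, 1) (1, 1, 0) = (1, 1, 0)" "pentagon_action (5, 0) (0, 0, 1) = (0, 0, 1)"
    by simp_all
  then show "ex 31 2" "ex 11 3"
    using mem ords ords' VH[of 31 2] VH[of 11 3] by blast+
  \<comment> \<open>Edges among 2, 3 and 5 are those of the complement, which is itself
    metacyclic.\<close>
  have HH: "ex p q \<longleftrightarrow> metacyclic_adj 15 2 11 p q" if pq: "p \<in> {2, 3, 5}" "q \<in> {2, 3, 5}" "p \<noteq> q" for p q
  proof -
    have "ex p q \<longleftrightarrow> (\<exists>h \<in> carrier pentagon_complement. pentagon.H.ord h = p * q)"
      unfolding ex_def using pq
      by (intro pentagon.exists_ord_HH_iff) (auto simp: order_pentagon_complement)
    also have "\<dots> \<longleftrightarrow> (p, q) \<in> parcs (prime_graph pentagon_complement)"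
      using pq by (auto simp: prime_graph_arcs_iff order_pentagon_complement prime_factors_dvd)
    also have "\<dots> \<longleftrightarrow> metacyclic_adj 15 2 11 p q"
      using pq by (intro prime_graph_metacyclic[OF pentagon_complement_valid]) auto
    finally show ?thesis .
  qed
  show "\<not> ex 2 3" "ex 2 5" "ex 3 5"
    by (simp_all add: HH metacyclic_adj_def)
qed

lemma cycle_graph_5_occurs: "occurs_as_solvable_prime_graph (cycle_graph 5)"
proof (rule occurs_as_solvable_prime_graphI)
  show "group pentagon_group" "finite (carrier pentagon_group)" "solvable pentagon_group"
    by (rule pentagon.group_semidirect pentagon.finite_semidirect pentagon.solvable_semidirect
        pentagon_complement_props)+
  let ?E = "{(0, 1), (1, 2), (2, 3), (3, 4), (4, 0)} :: (nat \<times> nat) set"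
  \<comment> \<open>The prime 31 occurs twice, once for each copy of the field with 31
    elements.\<close>
  have "order pentagon_group = prod_list [31, 31, 11, 2, 3, 5]"
    by (simp add: pentagon.order_semidirect order_pentagon_kernel order_pentagon_complement)
  moreover have "prime_factors (prod_list [31 :: nat, 31, 11, 2, 3, 5]) = set [31, 31, 11, 2, 3, 5]"
    by (rule prime_factors_prod_list_primes) auto
  ultimately have pf: "prime_factors (order pentagon_group) = {2, 31, 11, 3, 5}"
    by (simp only:) auto
  define ex where "ex p q \<longleftrightarrow> (\<exists>x \<in> carrier pentagon_group. group.ord pentagon_group x = p * q)" for p q
  have sym: "ex p q \<longleftrightarrow> ex q p" for p q by (simp add: ex_def mult.commute)
  note ex = pentagon_exists_ord_iff[folded ex_def]
  have ex': "ex 11 31" "ex 2 31" "\<not> ex 3 31" "\<not> ex 5 31" "\<not> ex 2 11" "ex 3 11" "\<not> ex 5 11"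
    "\<not> ex 3 2" "ex 5 2" "ex 5 3"
    using ex by (simp_all only: sym[of 11 31] sym[of 2 31] sym[of 3 31] sym[of 5 31] sym[of 2 11]
        sym[of 3 11] sym[of 5 11] sym[of 3 2] sym[of 5 2] sym[of 5 3] simp_thms)
  have arcs: "(p, q) \<in> parcs (prime_graph pentagon_group) \<longleftrightarrow>
      p \<in> {2, 31, 11, 3, 5} \<and> q \<in> {2, 31, 11, 3, 5} \<and> p \<noteq> q \<and> ex p q" for p q
    by (simp add: prime_graph_arcs_iff pf ex_def)
  \<comment> \<open>The list of primes goes once round the cycle.\<close>
  have "\<forall>i \<in> {..<5}. \<forall>j \<in> {..<5}. ([2, 31, 11, 3, 5] ! i, [2, 31, 11, 3, 5] ! j) \<in> parcs (prime_graph pentagon_group)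
      \<longleftrightarrow> (i, j) \<in> ?E \<or> (j, i) \<in> ?E"
    unfolding arcs using ex ex'
    by (simp add: lessThan_nat_numeral lessThan_Suc)
  then have "listing (prime_graph pentagon_group) 5 ?E [2, 31, 11, 3, 5]"
    by (auto simp: listing_def) (simp_all add: prime_graph_def pf)
  then show "digraph_iso (with_proj (prime_graph pentagon_group)) (with_proj (cycle_graph 5))"
    unfolding cycle_graph_5 using pair_graph_prime_graph listing_digraph_iso(1)
    by (rule_tac listing_digraph_iso(1)) (auto simp: irrefl_def pair_graph_prime_graph)
qed

theorem solvable_prime_graph_no_independent_triple:
  assumes "group G" "finite (carrier G)" "solvable G"
  shows "no_independent_triple (prime_graph G)"
  unfolding no_independent_triple_def
proof (intro ballI impI)
  fix p q r assume "p \<in> pverts (prime_graph G)" "q \<in> pverts (prime_graph G)" "r \<in> pverts (prime_graph G)"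
    and ne: "p \<noteq> q" "p \<noteq> r" "q \<noteq> r"
  then have pf: "p \<in> prime_factors (order G)" "q \<in> prime_factors (order G)" "r \<in> prime_factors (order G)"
    by (simp_all add: prime_graph_def)
  then have "\<exists>x \<in> carrier G. group.ord G x = p * q \<or> group.ord G x = p * r \<or> group.ord G x = q * r"
    using assms ne by (intro group.solvable_three_primes) (auto simp: in_prime_factors_iff)
  then show "(p, q) \<in> parcs (prime_graph G) \<or> (p, r) \<in> parcs (prime_graph G) \<or> (q, r) \<in> parcs (prime_graph G)"
    using pf ne by (auto simp: prime_graph_arcs_iff)
qed

lemma prime_graph_nonempty:
  assumes "group G" "finite (carrier G)" "carrier G \<noteq> {\<one>\<^bsub>G\<^esub>}"
  shows "pverts (prime_graph G) \<noteq> {}"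
proof -
  interpret group G by (rule assms)
  have "order G \<noteq> 1"
    using assms(3) one_closed unfolding order_def by (metis card_1_singletonE singletonD)
  then obtain p where "prime p" "p dvd order G" using prime_factor_nat by blast
  moreover have "order G \<noteq> 0" using assms(2) order_gt_0_iff_finite by simp
  ultimately have "p \<in> prime_factors (order G)" by (simp add: in_prime_factors_iff)
  then show ?thesis unfolding prime_graph_def by auto
qed

theorem corollary3:
  shows "(\<forall>G :: ('a, 'b) monoid_scheme.
            group G \<and> finite (carrier G) \<and> solvable G \<and> carrier G \<noteq> {\<one>\<^bsub>G\<^esub>} \<longrightarrow>
              (girth (prime_graph G) = 3 \<longleftrightarrow>
                 \<not> (digraph_iso (prime_graph G) (cycle_graph 4) \<or>
                    digraph_iso (prime_graph G) (cycle_graph 5) \<or>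
                    exceptional_forest (prime_graph G)))) \<and>
         occurs_as_solvable_prime_graph (cycle_graph 4) \<and>
         occurs_as_solvable_prime_graph (cycle_graph 5) \<and>
         (\<forall>F :: nat pair_pre_digraph.
            exceptional_forest F \<longrightarrow> occurs_as_solvable_prime_graph F) \<and>
         card ({F :: nat pair_pre_digraph. exceptional_forest F} //
               {(F, F'). exceptional_forest F \<and> exceptional_forest F' \<and> digraph_iso F F'}) = 7"
proof (intro conjI allI impI)
  fix G :: "('a, 'b) monoid_scheme"
  assume "group G \<and> finite (carrier G) \<and> solvable G \<and> carrier G \<noteq> {\<one>\<^bsub>G\<^esub>}"
  then have "pverts (prime_graph G) \<noteq> {}" "no_independent_triple (prime_graph G)"
    using prime_graph_nonempty solvable_prime_graph_no_independent_triple by blast+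
  then show "girth (prime_graph G) = 3 \<longleftrightarrow>
      \<not> (digraph_iso (prime_graph G) (cycle_graph 4) \<or> digraph_iso (prime_graph G) (cycle_graph 5) \<or>
        exceptional_forest (prime_graph G))"
    using triangle_free_small_graph_cases[OF pair_graph_prime_graph] girth_eq_3_iff[OF pair_graph_prime_graph]
    by blast
next
  fix F :: "nat pair_pre_digraph" assume "exceptional_forest F"
  \<comment> \<open>Occurrence is invariant under isomorphism, so the groups found for the seven
    representatives serve every exceptional forest.\<close>
  then obtain n A where "(n, A) \<in> small_forests" "digraph_iso (with_proj (graph_on n A)) (with_proj F)"
    using exceptional_forest_iso_small_forest by blast
  then show "occurs_as_solvable_prime_graph F"
    using small_forests_occur digraph_iso_trans unfolding occurs_as_solvable_prime_graph_def by blast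
qed (rule cycle_graph_4_occurs cycle_graph_5_occurs card_exceptional_forests_iso_classes)+

end
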